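(* Let $G$ be a finite abelian group of exponent $e$, let $P$ be the set of prime divisors of $|G|$, and write $G = \bigoplus_{r \in P} G_r$, where $G_r$ is the Sylow $r$-subgroup of $G$ and $$G_r \cong \bigoplus_{j=1}^{n_r} \mathbb{Z}/r^{a(r,j)}\mathbb{Z}$$ with integers $1 \leq a(r,1) \leq a(r,2) \leq \cdots \leq a(r,n_r)$. Then for every positive divisor $d$ of $e$, $$|\mathrm{I}_d(G)| = \prod_{r \in P} |\mathrm{I}_{d_r}(G_r)|,$$ where $d_r$ is the $r$-part of $d$. Moreover, for every $r \in P$ and every integer $l$ with $1 \leq l \leq a(r,n_r)$ and $(r,l) \neq (2,1)$, $$|\mathrm{I}_{r^l}(G_r)| = \prod_{j=1}^{n_r} r^{\min\{l,\, a(r,j)\}} - \prod_{j=1}^{n_r} r^{\min\{l-1,\, a(r,j)\}},$$ while, if $2 \in P$, $|\mathrm{I}_2(G_2)| = 2^{n_2}$.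
   Context: For a finite abelian group $A$, $\mathrm{Irr}(A)$ denotes the set of irreducible complex characters of $A$ (all of degree $1$). For $\chi \in \mathrm{Irr}(A)$, the character field is $\mathbb{Q}(\chi) = \mathbb{Q}(\{\chi(g) : g \in A\})$. For a positive integer $d$, $\zeta_d$ denotes a primitive complex $d$-th root of unity, and $\mathrm{I}_d(A) = \{\chi \in \mathrm{Irr}(A) : \mathbb{Q}(\chi) = \mathbb{Q}(\zeta_d)\}$. (Thus $\mathrm{I}_d(A) = \mathrm{I}_{2d}(A)$ for odd $d$.) The $r$-part of a positive integer $d$, for a prime $r$, is the largest power of $r$ dividing $d$ (equal to $1$ if $r \nmid d$). *)

theory Defs
  imports
    "HOL-Algebra.Elementary_Groups"
    "HOL-Algebra.Product_Groups"
    "HOL-Algebra.Generated_Fields"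
    "HOL-Computational_Algebra.Primes"
    "Jordan_Normal_Form.VS_Connect"
begin

definition GL :: "nat \<Rightarrow> complex mat monoid" where
  "GL n = units_of (ring_mat TYPE(complex) n ())"

definition irreducible_representation ::
    "('a, 'b) monoid_scheme \<Rightarrow> nat \<Rightarrow> ('a \<Rightarrow> complex mat) \<Rightarrow> bool" where
  "irreducible_representation A n \<rho> \<longleftrightarrow>
     n > 0 \<and> \<rho> \<in> hom A (GL n) \<and>
     (\<forall>W. VectorSpace.subspace class_ring W (module_vec TYPE(complex) n) \<and>
          (\<forall>g\<in>carrier A. \<forall>v\<in>W. \<rho> g *\<^sub>v v \<in> W) \<longrightarrow>
          W = {0\<^sub>v n} \<or> W = carrier_vec n)"

definition mat_trace :: "'c :: comm_monoid_add mat \<Rightarrow> 'c" where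
  "mat_trace M = (\<Sum>i<dim_row M. M $$ (i, i))"

text \<open>Characters are restricted to the carrier (they are \<open>undefined\<close> outside it), so that
  the elements of \<open>Irr A\<close> correspond one to one to functions on the carrier of \<open>A\<close>.\<close>

definition Irr :: "('a, 'b) monoid_scheme \<Rightarrow> ('a \<Rightarrow> complex) set" where
  "Irr A = {\<lambda>g\<in>carrier A. mat_trace (\<rho> g) | n \<rho>. irreducible_representation A n \<rho>}"

definition rat_adjoin :: "complex set \<Rightarrow> complex set" where
  "rat_adjoin S = generate_field class_ring (\<rat> \<union> S)"

definition character_field :: "('a, 'b) monoid_scheme \<Rightarrow> ('a \<Rightarrow> complex) \<Rightarrow> complex set" where
  "character_field A \<chi> = rat_adjoin (\<chi> ` carrier A)"

text \<open>The field generated by a primitive \<open>d\<close>-th root of unity does not depend on which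
  one is chosen.\<close>

definition zeta :: "nat \<Rightarrow> complex" where
  "zeta d = cis (2 * pi / real d)"

definition I_chars :: "nat \<Rightarrow> ('a, 'b) monoid_scheme \<Rightarrow> ('a \<Rightarrow> complex) set" where
  "I_chars d A = {\<chi> \<in> Irr A. character_field A \<chi> = rat_adjoin {zeta d}}"

definition group_exponent :: "('a, 'b) monoid_scheme \<Rightarrow> nat" where
  "group_exponent A = (LEAST m. m > 0 \<and> (\<forall>x\<in>carrier A. x [^]\<^bsub>A\<^esub> m = \<one>\<^bsub>A\<^esub>))"

definition prime_part :: "nat \<Rightarrow> nat \<Rightarrow> nat" where
  "prime_part r d = r ^ multiplicity r d"

definition sylow_subgroup :: "('a, 'b) monoid_scheme \<Rightarrow> nat \<Rightarrow> 'a set \<Rightarrow> bool" where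
  "sylow_subgroup A r H \<longleftrightarrow> subgroup H A \<and> card H = prime_part r (Coset.order A)"

end

theory Submission
  imports Defs "HOL-Number_Theory.Residues" "Jordan_Normal_Form.Spectral_Radius"
begin

text \<open>The irreducible characters of a finite abelian group \<open>A\<close> are its homomorphisms \<open>\<chi>\<close> to the
  multiplicative group of \<open>\<complex>\<close> (\<open>Irr_eq_lin_chars\<close>, by Schur's lemma). The image of \<open>\<chi>\<close> is the group of
  all \<open>m\<close>-th roots of unity, where \<open>m\<close> is the order of \<open>\<chi>\<close>, so its character field is \<open>\<rat>(\<zeta>\<^sub>m)\<close>
  (\<open>character_field_lin_char\<close>). Two cyclotomic fields \<open>\<rat>(\<zeta>\<^sub>m)\<close> and \<open>\<rat>(\<zeta>\<^sub>d)\<close> coincide exactly if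
  \<open>lcm 2 m = lcm 2 d\<close> (\<open>cyclotomic_field_eq_iff\<close>). Hence membership in \<open>I_chars d A\<close> is a condition on
  the order of the character alone (\<open>I_chars_eq\<close>), and the theorem becomes a count of characters by
  order.

  The arithmetic content is the comparison of cyclotomic fields. It rests on the irreducibility of
  cyclotomic polynomials, in the form that every integer polynomial relation satisfied by a root of
  unity \<open>z\<close> of order dividing \<open>n\<close> is satisfied by \<open>z\<^sup>k\<close> for all \<open>k\<close> coprime to \<open>n\<close>
  (\<open>root_of_unity_conjugate\<close>). If \<open>\<zeta>\<^sub>m\<close> lies in \<open>\<rat>(\<zeta>\<^sub>d)\<close>, every such conjugation that fixes \<open>\<zeta>\<^sub>d\<close> must
  fix \<open>\<zeta>\<^sub>m\<close>, and elementary congruences then give that \<open>m\<close> divides \<open>lcm 2 d\<close>.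

  For the product formula, restriction to the Sylow subgroups identifies the dual group of \<open>G\<close> with the
  product of the dual groups of the Sylow subgroups, and the order of the restriction to the Sylow
  \<open>r\<close>-subgroup is the \<open>r\<close>-part of the order (\<open>bij_betw_restrict_sylow\<close>,
  \<open>char_order_restrict_sylow\<close>); the condition on orders can be tested prime by prime.

  For a primary group, the characters of order dividing \<open>r ^ l\<close> are easily counted: on a direct sum of
  cyclic groups one chooses a root of unity for each generator (\<open>card_torsion_chars_sum_group\<close>). The
  characters of exact order \<open>r ^ l\<close> are obtained by subtracting those of order dividing
  \<open>r ^ (l - 1)\<close>; only for \<open>r ^ l = 2\<close> no subtraction takes place, as \<open>\<rat>(\<zeta>\<^sub>2) = \<rat>\<close>.\<close>

section \<open>Conjugates of roots of unity\<close>

abbreviation ipoly_at :: "int poly \<Rightarrow> complex \<Rightarrow> complex" where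
  "ipoly_at q z \<equiv> poly (map_poly of_int q) z"

lemma ipoly_at_simps [simp]:
  "ipoly_at (p + q) z = ipoly_at p z + ipoly_at q z"
  "ipoly_at (p - q) z = ipoly_at p z - ipoly_at q z"
  "ipoly_at (- p) z = - ipoly_at p z"
  "ipoly_at (p * q) z = ipoly_at p z * ipoly_at q z"
  "ipoly_at (p ^ k) z = ipoly_at p z ^ k"
  "ipoly_at (Polynomial.smult c p) z = of_int c * ipoly_at p z"
  "ipoly_at (pcompose p q) z = ipoly_at p (ipoly_at q z)"
  "ipoly_at (of_nat m) z = of_nat m"
  "ipoly_at [:c:] z = of_int c"
  by (simp_all add: hom_distribs poly_pcompose)

declare poly_monom [simp]

text \<open>Gauss's lemma: an integer polynomial of least degree vanishing at \<open>z\<close>, made primitive, divides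
over \<open>\<int>\<close> every integer polynomial vanishing at \<open>z\<close>. As it divides \<open>X\<^sup>n - 1\<close>, its leading
coefficient is a unit, so that one can divide by it with remainder in \<open>\<int>[X]\<close>.\<close>

lemma integral_minimal_polynomial:
  fixes z :: complex
  assumes "z ^ n = 1" "n > 0"
  obtains f :: "int poly" where "is_unit (lead_coeff f)" "ipoly_at f z = 0"
    "\<And>q. ipoly_at q z = 0 \<Longrightarrow> f dvd q"
proof -
  let ?P = "\<lambda>f :: int poly. f \<noteq> 0 \<and> ipoly_at f z = 0"
  define x where "x = monom (1::int) n - 1"
  have x: "?P x" "lead_coeff x = 1"
  proof -
    have "coeff x n = 1" using assms by (simp add: x_def)
    moreover have "degree x \<le> n"
      unfolding x_def by (intro degree_diff_le degree_monom_le) auto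
    ultimately show "lead_coeff x = 1"
      by (metis le_antisym le_degree one_neq_zero)
    then show "?P x" using assms by (auto simp: x_def poly_monom)
  qed
  obtain f0 where f0: "?P f0" "\<And>q. ?P q \<Longrightarrow> degree f0 \<le> degree q"
    using ex_has_least_nat[of ?P x degree] x by blast
  define f where "f = primitive_part f0"
  have f0f: "f0 = Polynomial.smult (content f0) f"
    by (simp add: f_def)
  have cf: "content f = 1" using f0 by (simp add: f_def content_primitive_part)
  have fz: "ipoly_at f z = 0"
  proof -
    have "of_int (content f0) * ipoly_at f z = 0"
      using f0(1) f0f by (metis ipoly_at_simps(6))
    moreover have "content f0 \<noteq> 0" using f0 by simp
    ultimately show ?thesis by simp
  qed
  have fn: "f \<noteq> 0" using cf by auto
  have fmin: "degree f \<le> degree q" if "?P q" for q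
    using f0(2)[OF that] by (simp add: f_def)
  have dvd: "f dvd q" if q: "ipoly_at q z = 0" for q
  proof -
    \<comment> \<open>Pseudo-division leaves no remainder by minimality; the content argument then removes the factor \<open>a\<close>.\<close>
    obtain a s r where a: "a \<noteq> 0" "Polynomial.smult a q = f * s + r" "r = 0 \<or> degree r < degree f"
      using pseudo_mod[OF fn, of q] by blast
    have "ipoly_at (Polynomial.smult a q) z = ipoly_at (f * s + r) z" using a by simp
    hence "ipoly_at r z = 0" using q fz by simp
    with a(3) fmin[of r] have "r = 0" using leD by blast
    hence qs: "Polynomial.smult a q = f * s" using a by simp
    have "content (Polynomial.smult a q) = content s"
      unfolding qs by (simp add: content_mult cf)
    hence "a dvd content s" by (metis content_smult dvd_triv_left normalize_dvd_iff)
    hence "[:a:] dvd s" by (simp add: const_poly_dvd_iff_dvd_content)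
    then obtain s' where "s = [:a:] * s'" by (rule dvdE)
    hence s': "s = Polynomial.smult a s'" by simp
    have "Polynomial.smult a q = Polynomial.smult a (f * s')" using qs s' by simp
    hence "Polynomial.smult a (q - f * s') = 0" by (simp add: smult_diff_right)
    hence "q = f * s'" using a(1) by simp
    thus ?thesis by simp
  qed
  have "f dvd x" using dvd x by blast
  then obtain g where "x = f * g" by auto
  hence "lead_coeff f * lead_coeff g = 1" using x(2) by (simp add: lead_coeff_mult)
  hence "is_unit (lead_coeff f)" by (metis dvd_triv_left)
  thus thesis using that fz dvd by blast
qed

lemma prime_dvd_add_power_diff:
  fixes x y :: "'a :: comm_ring_1"
  assumes "prime p"
  shows "of_nat p dvd (x + y) ^ p - x ^ p - y ^ p"
proof -
  have p: "p > 1" using assms prime_gt_1_nat by blast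
  have "(x + y) ^ p = (\<Sum>k\<le>p. of_nat (p choose k) * x ^ k * y ^ (p - k))"
    by (rule binomial_ring)
  also have "{..p} = insert 0 (insert p {0<..<p})" using p by auto
  also have "(\<Sum>k\<in>\<dots>. of_nat (p choose k) * x ^ k * y ^ (p - k)) =
     y ^ p + (x ^ p + (\<Sum>k\<in>{0<..<p}. of_nat (p choose k) * x ^ k * y ^ (p - k)))"
    using p by (subst sum.insert; simp)+
  finally have "(x + y) ^ p - x ^ p - y ^ p = (\<Sum>k\<in>{0<..<p}. of_nat (p choose k) * x ^ k * y ^ (p - k))"
    by simp
  also have "of_nat p dvd \<dots>"
  proof (rule dvd_sum)
    fix k assume "k \<in> {0<..<p}"
    hence "p dvd (p choose k)" using assms by (intro dvd_choose_prime) auto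
    then obtain m where "p choose k = p * m" by (rule dvdE)
    thus "of_nat p dvd of_nat (p choose k) * x ^ k * y ^ (p - k)"
      by (simp add: mult.assoc)
  qed
  finally show ?thesis .
qed

lemma int_prime_dvd_power_diff:
  assumes "prime p" shows "int p dvd a ^ p - a"
proof -
  have p: "p > 0" using assms prime_gt_0_nat by blast
  define b where "b = nat (a mod int p)"
  have ab: "[a = int b] (mod int p)" using p by (simp add: b_def cong_def)
  have "[b ^ p = b] (mod p)"
  proof (cases "p dvd b")
    case True
    thus ?thesis using p by (simp add: cong_def mod_eq_0_iff_dvd dvd_power_iff_le)
       (metis dvd_power dvd_trans)
  next
    case False
    have "[b ^ (p - 1) * b = 1 * b] (mod p)"
      by (rule cong_scalar_right[OF fermat_theorem[OF assms False]])
    thus ?thesis using p by (simp add: power_eq_if mult.commute)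
  qed
  hence "[int b ^ p = int b] (mod int p)" by (metis cong_int_iff of_nat_power)
  with ab have "[a ^ p = a] (mod int p)" by (meson cong_pow cong_sym cong_trans)
  thus ?thesis by (simp add: cong_iff_dvd_diff)
qed

text \<open>The congruence \<open>g(X\<^sup>p) \<equiv> g(X)\<^sup>p\<close> modulo \<open>p\<close>, kept as a divisibility in \<open>\<int>[X]\<close> so that it can be
evaluated at a root of unity without passing to residue fields.\<close>

lemma frobenius_poly:
  fixes g :: "int poly"
  assumes "prime p"
  shows "of_nat p dvd pcompose g (monom 1 p) - g ^ p"
proof (induction g)
  case 0
  show ?case using assms prime_gt_0_nat[of p] by (simp add: power_0_left)
next
  case (pCons a g)
  let ?X = "monom (1::int) 1"
  have e: "pCons a g = [:a:] + ?X * g" by (simp add: monom_altdef)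
  have 1: "of_nat p dvd ([:a:] + ?X * g) ^ p - [:a:] ^ p - (?X * g) ^ p"
    by (rule prime_dvd_add_power_diff[OF assms])
  have 2: "of_nat p dvd [:a:] ^ p - [:a:]"
  proof -
    obtain k where "a ^ p - a = int p * k" using int_prime_dvd_power_diff[OF assms] by (rule dvdE)
    hence "[:a:] ^ p - [:a:] = of_nat p * [:k:]"
      by (simp add: poly_const_pow of_nat_poly)
    thus ?thesis by (metis dvd_triv_left)
  qed
  have 3: "of_nat p dvd monom 1 p * (pcompose g (monom 1 p) - g ^ p)"
    using pCons.IH by (rule dvd_mult)
  have "pcompose (pCons a g) (monom 1 p) - (pCons a g) ^ p =
      monom 1 p * (pcompose g (monom 1 p) - g ^ p) - ([:a:] ^ p - [:a:])
       - (([:a:] + ?X * g) ^ p - [:a:] ^ p - (?X * g) ^ p)"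
    unfolding pcompose_pCons unfolding e
    by (simp add: power_mult_distrib monom_power algebra_simps)
  thus ?case using 1 2 3 by (metis dvd_diff)
qed

text \<open>Dedekind's argument for the irreducibility of cyclotomic polynomials, carried out in \<open>\<int>[z]\<close>. Write
\<open>X\<^sup>n - 1 = f g\<close> with \<open>f\<close> minimal for \<open>z\<close>. If \<open>f(z\<^sup>p) \<noteq> 0\<close> then \<open>g(z\<^sup>p) = 0\<close>, so \<open>g(z)\<^sup>p\<close> is a multiple
of \<open>p\<close> in \<open>\<int>[z]\<close>. Differentiating gives \<open>n z\<^sup>n = f'(z) g(z) z\<close>, whence \<open>n\<^sup>p \<in> p \<int>[z]\<close>. Since \<open>\<int>[z]\<close> has a
\<open>\<int>\<close>-basis of powers of \<open>z\<close> containing \<open>1\<close>, this forces \<open>p\<close> to divide \<open>n\<close>.\<close>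

lemma root_of_unity_conjugate_prime:
  fixes z :: complex and q :: "int poly"
  assumes z: "z ^ n = 1" and n: "n > 0" and p: "prime p" "\<not> p dvd n"
    and q: "ipoly_at q z = 0"
  shows "ipoly_at q (z ^ p) = 0"
proof -
  obtain f :: "int poly" where f: "is_unit (lead_coeff f)" "ipoly_at f z = 0"
    "\<And>q. ipoly_at q z = 0 \<Longrightarrow> f dvd q"
    using integral_minimal_polynomial[OF z n] by blast
  have fn: "f \<noteq> 0" using f(1) by auto
  have "ipoly_at f (z ^ p) = 0"
  proof (rule ccontr)
    assume nz: "ipoly_at f (z ^ p) \<noteq> 0"
    define x where "x = monom (1::int) n - 1"
    have "f dvd x" using f(3)[of x] z by (simp add: x_def poly_monom)
    then obtain g where g: "x = f * g" by auto
    have "ipoly_at x (z ^ p) = 0"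
    proof -
      have "(z ^ p) ^ n = (z ^ n) ^ p" by (simp add: mult.commute flip: power_mult)
      thus ?thesis using z by (simp add: x_def poly_monom)
    qed
    hence gp: "ipoly_at g (z ^ p) = 0" using g nz by simp
    obtain h where h: "pcompose g (monom 1 p) - g ^ p = of_nat p * h"
      using frobenius_poly[OF p(1)] by (rule dvdE)
    have "ipoly_at (pcompose g (monom 1 p) - g ^ p) z = ipoly_at (of_nat p * h) z" by (simp only: h)
    hence "- (ipoly_at g z ^ p) = of_nat p * ipoly_at h z" using gp by simp
    hence gh: "ipoly_at g z ^ p = - (of_nat p * ipoly_at h z)" by (metis minus_minus)
    have "pderiv x = pderiv f * g + f * pderiv g" unfolding g by (simp add: pderiv_mult algebra_simps)
    hence "ipoly_at (pderiv x) z = ipoly_at (pderiv f) z * ipoly_at g z" using f(2) by simp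
    hence d: "of_nat n * z ^ (n - 1) = ipoly_at (pderiv f) z * ipoly_at g z"
      by (simp add: x_def pderiv_diff pderiv_monom)
    have "z ^ (n - 1) * z = 1" using z power_minus_mult[OF n, of z] by simp
    hence "of_nat n * z ^ (n - 1) * z = of_nat n" by (simp add: mult.assoc)
    hence "ipoly_at (pderiv f) z * ipoly_at g z * z = of_nat n" unfolding d .
    hence "of_nat n ^ p = (ipoly_at (pderiv f) z * ipoly_at g z * z) ^ p" by simp
    also have "\<dots> = ipoly_at (pderiv f) z ^ p * ipoly_at g z ^ p * z ^ p"
      by (simp add: power_mult_distrib)
    also have "\<dots> = of_nat p * ipoly_at (- (pderiv f ^ p * h * monom 1 p)) z"
      unfolding gh by simp
    finally obtain w where w: "of_nat n ^ p = of_nat p * ipoly_at w z" by blast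
    \<comment> \<open>Reducing \<open>w\<close> modulo \<open>f\<close> expresses \<open>w(z)\<close> in the power basis. Pseudo-division multiplies \<open>w\<close> by \<open>c\<close>, which is its own inverse.\<close>
    obtain s r where sr: "w = f * s + r" "r = 0 \<or> degree r < degree f"
    proof -
      define c where "c = lead_coeff f ^ (Suc (degree w) - degree f)"
      obtain s r where "pseudo_divmod w f = (s, r)" by fastforce
      hence "Polynomial.smult c w = f * s + r" "r = 0 \<or> degree r < degree f"
        using pseudo_divmod[OF fn] unfolding c_def by blast+
      moreover have "c * c = 1"
      proof -
        have "lead_coeff f = 1 \<or> lead_coeff f = - 1" using f(1) by auto
        hence "lead_coeff f * lead_coeff f = 1" by auto
        thus ?thesis unfolding c_def by (simp flip: power_mult_distrib)
      qed
      ultimately have "w = f * Polynomial.smult c s + Polynomial.smult c r"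
        by (metis mult_smult_right smult_add_right smult_smult smult_1_left)
      moreover have "Polynomial.smult c r = 0 \<or> degree (Polynomial.smult c r) < degree f"
        using \<open>r = 0 \<or> degree r < degree f\<close> by auto
      ultimately show thesis using that by blast
    qed
    define u where "u = [:int n ^ p:] - Polynomial.smult (int p) r"
    have "ipoly_at u z = 0" using w sr(1) f(2) by (simp add: u_def)
    hence "f dvd u" by (rule f(3))
    have df: "degree f > 0"
    proof (rule ccontr)
      assume "\<not> degree f > 0"
      then obtain c where "f = [:c:]" by (metis degree_0_id gr0I)
      thus False using f(2) fn by simp
    qed
    have "degree u < degree f"
      unfolding u_def using sr(2) df by (intro degree_diff_less) auto
    with \<open>f dvd u\<close> have "u = 0" using dvd_imp_degree_le leD by blast
    hence "coeff u 0 = 0" by simp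
    hence "int n ^ p = int p * coeff r 0" by (simp add: u_def)
    hence "int p dvd int n ^ p" by simp
    hence "p dvd n ^ p" by (metis of_nat_dvd_iff of_nat_power)
    thus False using p prime_dvd_power by blast
  qed
  moreover obtain t where "q = f * t" using f(3)[OF q] by (rule dvdE)
  ultimately show ?thesis by simp
qed

text \<open>This replaces the Galois group: raising to the \<open>k\<close>-th power preserves every algebraic relation over
\<open>\<rat>\<close>. Stating it for all roots of \<open>X\<^sup>n - 1\<close> lets the induction over the prime factors of
\<open>k\<close> pass from \<open>z\<close> to \<open>z\<^sup>p\<close> without tracking orders.\<close>

lemma root_of_unity_conjugate:
  fixes z :: complex and q :: "int poly"
  assumes "z ^ n = 1" and n: "n > 0" and "coprime k n" and "ipoly_at q z = 0" and "k > 0"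
  shows "ipoly_at q (z ^ k) = 0"
  using assms(1,3,4,5)
proof (induction k arbitrary: z rule: prime_divisors_induct)
  case (unit k)
  thus ?case by simp
next
  case (factor p k)
  have "coprime p n" "coprime k n" "k > 0" using factor.prems by auto
  have "\<not> p dvd n" using \<open>coprime p n\<close> factor.hyps
    by (metis coprime_absorb_left not_prime_unit)
  hence "ipoly_at q (z ^ p) = 0"
    using root_of_unity_conjugate_prime n factor.prems factor.hyps by blast
  moreover have "(z ^ p) ^ n = 1" using factor.prems(1)
    by (metis power_mult power_one mult.commute)
  ultimately have "ipoly_at q ((z ^ p) ^ k) = 0"
    using factor.IH \<open>coprime k n\<close> \<open>k > 0\<close> by blast
  thus ?case by (simp add: power_mult)
qed simp

section \<open>Cyclotomic fields\<close>

lemma rat_adjoin_closed: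
  "x \<in> \<rat> \<Longrightarrow> x \<in> rat_adjoin S"
  "x \<in> S \<Longrightarrow> x \<in> rat_adjoin S"
  "x \<in> rat_adjoin S \<Longrightarrow> y \<in> rat_adjoin S \<Longrightarrow> x + y \<in> rat_adjoin S"
  "x \<in> rat_adjoin S \<Longrightarrow> y \<in> rat_adjoin S \<Longrightarrow> x * y \<in> rat_adjoin S"
  "x \<in> rat_adjoin S \<Longrightarrow> - x \<in> rat_adjoin S"
  unfolding rat_adjoin_def
  using generate_field.incl[of x "\<rat> \<union> S" class_ring]
    generate_field.eng_add[of x class_ring "\<rat> \<union> S" y]
    generate_field.eng_mult[of x class_ring "\<rat> \<union> S" y]
    generate_field.a_inv[of x class_ring "\<rat> \<union> S"]
  by (auto simp: class_ring_simps)

lemma rat_adjoin_power: "x \<in> rat_adjoin S \<Longrightarrow> x ^ k \<in> rat_adjoin S"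
  by (induction k) (auto intro: rat_adjoin_closed)

lemma rat_adjoin_subset:
  assumes "S \<subseteq> rat_adjoin T" shows "rat_adjoin S \<subseteq> rat_adjoin T"
proof
  fix x assume "x \<in> rat_adjoin S"
  hence "x \<in> generate_field class_ring (\<rat> \<union> S)" by (simp add: rat_adjoin_def)
  thus "x \<in> rat_adjoin T"
  proof induction
    case (incl h)
    thus ?case using assms rat_adjoin_closed(1) by auto
  qed (simp_all only: rat_adjoin_def generate_field.intros not_False_eq_True)
qed

text \<open>Elements of \<open>\<rat>(z)\<close> are taken as fractions rather than polynomials in \<open>z\<close>, because closure under
inverses is then immediate.\<close>

lemma rat_adjoin_fraction:
  assumes "x \<in> rat_adjoin {z}"
  shows "\<exists>u v. ipoly_at v z \<noteq> 0 \<and> x * ipoly_at v z = ipoly_at u z"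
proof -
  have frac: "\<exists>u v. ipoly_at v z \<noteq> 0 \<and> h * ipoly_at v z = ipoly_at u z"
    if "ipoly_at v z \<noteq> 0" "h * ipoly_at v z = ipoly_at u z" for v h u
    using that by blast
  have "x \<in> generate_field class_ring (\<rat> \<union> {z})" using assms by (simp add: rat_adjoin_def)
  thus ?thesis
  proof induction
    case one
    show ?case by (intro frac[of 1 _ 1]) simp_all
  next
    case (incl h)
    show ?case
    proof (cases "h = z")
      case True
      thus ?thesis by (intro frac[of 1 _ "monom 1 1"]) simp_all
    next
      case False
      with incl have "h \<in> \<rat>" by simp
      then obtain a b where ab: "b \<noteq> 0" "h = of_int a / of_int b"
        by (metis Rats_cases' of_int_0_less_iff less_irrefl)
      thus ?thesis by (intro frac[of "[:b:]" _ "[:a:]"]) simp_all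
    qed
  next
    case (a_inv h)
    then obtain u v where "ipoly_at v z \<noteq> 0" "h * ipoly_at v z = ipoly_at u z" by blast
    thus ?case by (intro frac[of v _ "- u"]) (simp_all add: class_ring_simps)
  next
    case (m_inv h)
    then obtain u v where uv: "ipoly_at v z \<noteq> 0" "h * ipoly_at v z = ipoly_at u z" by blast
    have "h \<noteq> 0" using m_inv by simp
    thus ?case using uv
      by (intro frac[of u _ v]) (auto simp: class_ring_simps field_simps)
  next
    case (eng_add h1 h2)
    then obtain u v u' v' where uv: "ipoly_at v z \<noteq> 0" "h1 * ipoly_at v z = ipoly_at u z"
      "ipoly_at v' z \<noteq> 0" "h2 * ipoly_at v' z = ipoly_at u' z" by blast
    thus ?case
      by (intro frac[of "v * v'" _ "u * v' + u' * v"]) (simp_all add: algebra_simps flip: uv(2,4))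
  next
    case (eng_mult h1 h2)
    then obtain u v u' v' where uv: "ipoly_at v z \<noteq> 0" "h1 * ipoly_at v z = ipoly_at u z"
      "ipoly_at v' z \<noteq> 0" "h2 * ipoly_at v' z = ipoly_at u' z" by blast
    thus ?case
      by (intro frac[of "v * v'" _ "u * u'"]) (simp_all add: algebra_simps flip: uv(2,4))
  qed
qed

lemma zeta_power: "zeta d ^ k = cis (2 * pi * real k / real d)"
  by (simp add: zeta_def DeMoivre mult_ac)

lemma zeta_mult_power: "k > 0 \<Longrightarrow> zeta (k * d) ^ k = zeta d"
  unfolding zeta_power by (simp add: zeta_def)

lemma zeta_power_self: "d > 0 \<Longrightarrow> zeta d ^ d = 1"
  by (simp add: zeta_power)

lemma zeta_power_eq_1_iff:
  assumes "d > 0" shows "zeta d ^ k = 1 \<longleftrightarrow> d dvd k"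
proof -
  have "zeta d ^ k = zeta d ^ (d * (k div d) + k mod d)" by simp
  also have "\<dots> = zeta d ^ (k mod d)"
    by (simp only: power_add power_mult zeta_power_self[OF assms] power_one mult_1_left)
  finally have "zeta d ^ k = zeta d ^ (k mod d)" .
  moreover have "inj_on (\<lambda>k. zeta d ^ k) {..<d}"
    using bij_betw_roots_unity[OF assms] by (simp add: zeta_power bij_betw_def)
  hence "zeta d ^ (k mod d) = zeta d ^ 0 \<longleftrightarrow> k mod d = 0"
    using assms by (intro inj_on_eq_iff) auto
  ultimately show ?thesis by (simp add: mod_eq_0_iff_dvd)
qed

text \<open>The hypothesis says that a unit modulo \<open>lcm m d\<close> is trivial modulo \<open>m\<close> once it is trivial modulo \<open>d\<close>,
that is, the unit groups modulo \<open>N = lcm m d\<close> and modulo \<open>d\<close> agree. For a prime \<open>p\<close> dividing \<open>N / d\<close>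
the numbers \<open>1 + j N / p\<close> with \<open>0 < j < p\<close> are trivial modulo \<open>d\<close> but not modulo \<open>N\<close>, so none of them
may be a unit; this leaves only \<open>p = 2\<close> with \<open>d\<close> and \<open>N / 2\<close> odd.\<close>

lemma dvd_lcm_2_if_congruence_kernel:
  fixes m d :: nat
  assumes m: "m > 0" and d: "d > 0"
    and ker: "\<And>k. k > 0 \<Longrightarrow> coprime k (lcm m d) \<Longrightarrow> [k = 1] (mod d) \<Longrightarrow> [k = 1] (mod m)"
  shows "m dvd lcm 2 d"
proof (cases "m dvd d")
  case False
  define N where "N = lcm m d"
  have N: "N > 0" using m d by (simp add: N_def lcm_pos_nat)
  have "d dvd N" by (simp add: N_def)
  then obtain t where t: "N = d * t" by (rule dvdE)
  have kerN: "[k = 1] (mod N)" if "k > 0" "coprime k N" "[k = 1] (mod d)" for k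
  proof (cases k)
    case (Suc j)
    have "[k = 1] (mod m)" using ker that N_def by blast
    with that Suc show ?thesis
      by (auto simp: N_def cong_altdef_nat)
  qed (use that in simp)
  have prime2: "p = 2 \<and> odd d \<and> odd (N div 2)" if p: "prime p" "p dvd t" for p
  proof -
    define M where "M = N div p"
    have "p dvd N" using p t by simp
    hence NM: "N = p * M" by (simp add: M_def)
    have "d dvd M" using p(2) d p(1) t unfolding M_def
      by (metis div_mult_swap dvd_triv_left)
    have M0: "M > 0" using NM N by simp
    have pdvd: "p dvd 1 + j * M" if j: "0 < j" "j < p" for j
    proof (rule ccontr)
      assume "\<not> p dvd 1 + j * M"
      hence "coprime (1 + j * M) p" using p(1) prime_imp_coprime coprime_commute by blast
      moreover have "coprime (1 + j * M) M"
        by (metis coprime_1_left coprime_iff_gcd_eq_1 gcd_add_mult mult.commute gcd.commute add.commute)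
      ultimately have "coprime (1 + j * M) N" by (simp add: NM)
      moreover have "[1 + j * M = 1] (mod d)"
        using \<open>d dvd M\<close> by (simp add: cong_altdef_nat)
      ultimately have "[1 + j * M = 1] (mod N)" by (intro kerN) auto
      hence "p * M dvd j * M" by (simp add: cong_altdef_nat NM)
      hence "p dvd j" using M0 by simp
      thus False using j by (simp add: nat_dvd_not_less)
    qed
    have p2: "p \<ge> 2" using p(1) prime_ge_2_nat by blast
    have 1: "p dvd 1 + M" using pdvd[of 1] p2 by simp
    have nM: "\<not> p dvd M" using 1 p(1)
      by (metis dvd_add_left_iff not_prime_unit)
    have "p = 2"
    proof (rule ccontr)
      assume "p \<noteq> 2"
      hence "p dvd 1 + 2 * M" using pdvd[of 2] p2 by simp
      hence "p dvd (1 + 2 * M) - (1 + M)" using 1 by (rule dvd_diff_nat)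
      thus False using nM by simp
    qed
    thus ?thesis using nM \<open>d dvd M\<close> M_def by auto
  qed
  have "t \<noteq> 1"
  proof
    assume "t = 1"
    hence "N = d" using t by simp
    thus False using False by (metis N_def dvd_lcm1)
  qed
  then obtain p where p: "prime p" "p dvd t" using prime_factor_nat by blast
  have "2 dvd t" and d_odd: "odd d" and "odd (N div 2)" using prime2[OF p] p by auto
  then obtain s where s: "t = 2 * s" by blast
  have "odd s" using \<open>odd (N div 2)\<close> by (simp add: t s)
  have "s = 1"
  proof (rule ccontr)
    assume "s \<noteq> 1"
    then obtain q where q: "prime q" "q dvd s" using prime_factor_nat by blast
    hence "q = 2" using prime2[of q] s by simp
    thus False using q \<open>odd s\<close> by simp
  qed
  hence "N = 2 * d" using t s by simp
  moreover have "lcm 2 d = 2 * d" using d_odd by (simp add: lcm_coprime)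
  ultimately show ?thesis by (metis N_def dvd_lcm1)
qed auto

text \<open>If \<open>\<zeta>\<^sub>m\<close> is a fraction \<open>u(\<zeta>\<^sub>d) / v(\<zeta>\<^sub>d)\<close>, this relation is an integer polynomial \<open>q\<close> vanishing at
\<open>\<zeta>\<^sub>N\<close>. Conjugating by \<open>k \<equiv> 1\<close> modulo \<open>d\<close> fixes the right-hand side and therefore fixes \<open>\<zeta>\<^sub>m\<close>.\<close>

lemma zeta_in_cyclotomic_imp_dvd:
  assumes m: "m > 0" and d: "d > 0" and "zeta m \<in> rat_adjoin {zeta d}"
  shows "m dvd lcm 2 d"
proof (rule dvd_lcm_2_if_congruence_kernel[OF m d])
  fix k assume k: "k > 0" "coprime k (lcm m d)" "[k = 1] (mod d)"
  define N where "N = lcm m d"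
  have N: "N > 0" using m d by (simp add: N_def lcm_pos_nat)
  obtain m' where m': "N = m' * m" unfolding N_def by (metis dvd_lcm1 dvd_def mult.commute)
  obtain d' where d': "N = d' * d" unfolding N_def by (metis dvd_lcm2 dvd_def mult.commute)
  have zm: "zeta N ^ m' = zeta m" using m' N zeta_mult_power[of m' m] by simp
  have zd: "zeta N ^ d' = zeta d" using d' N zeta_mult_power[of d' d] by simp
  obtain u v where uv: "ipoly_at v (zeta d) \<noteq> 0"
      "zeta m * ipoly_at v (zeta d) = ipoly_at u (zeta d)"
    using rat_adjoin_fraction[OF assms(3)] by blast
  define q where "q = monom 1 m' * pcompose v (monom 1 d') - pcompose u (monom 1 d')"
  have q_at: "ipoly_at q (zeta N ^ j) = zeta m ^ j * ipoly_at v (zeta d ^ j) - ipoly_at u (zeta d ^ j)" for j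
  proof -
    have "(zeta N ^ j) ^ m' = zeta m ^ j" "(zeta N ^ j) ^ d' = zeta d ^ j"
      using zm zd by (metis power_mult mult.commute)+
    thus ?thesis by (simp add: q_def)
  qed
  have "ipoly_at q (zeta N) = 0" using q_at[of 1] uv by simp
  hence "ipoly_at q (zeta N ^ k) = 0"
    using root_of_unity_conjugate[OF zeta_power_self[OF N] N] k N_def by blast
  moreover have "zeta d ^ k = zeta d"
  proof -
    obtain j where "k = Suc j" using k by (cases k) auto
    hence "d dvd j" using k(3) by (simp add: cong_altdef_nat)
    thus ?thesis using \<open>k = Suc j\<close> zeta_power_eq_1_iff[OF d, of j] by simp
  qed
  ultimately have "zeta m ^ k * ipoly_at v (zeta d) = zeta m * ipoly_at v (zeta d)"
    using q_at[of k] uv by simp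
  hence zk: "zeta m ^ k = zeta m" using uv(1) by simp
  obtain j where j: "k = Suc j" using k by (cases k) auto
  have "zeta m \<noteq> 0" by (simp add: zeta_def)
  with zk j have "zeta m ^ j = 1" by simp
  hence "m dvd j" using zeta_power_eq_1_iff[OF m] by blast
  thus "[k = 1] (mod m)" using j by (simp add: cong_altdef_nat)
qed

lemma dvd_imp_zeta_in_cyclotomic:
  assumes d: "d > 0" and "m dvd lcm 2 d"
  shows "zeta m \<in> rat_adjoin {zeta d}"
proof -
  have self: "zeta d \<in> rat_adjoin {zeta d}" by (simp add: rat_adjoin_closed(2))
  have "zeta (lcm 2 d) \<in> rat_adjoin {zeta d}"
  proof (cases "even d")
    case True
    hence "lcm 2 d = d" by (simp add: lcm_proj2_if_dvd_nat)
    thus ?thesis using self by simp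
  next
    case False
    hence l: "lcm 2 d = 2 * d" by (simp add: lcm_coprime)
    obtain c where c: "d + 1 = 2 * c" using False by (metis even_plus_one_iff evenE)
    \<comment> \<open>For odd \<open>d\<close> the primitive \<open>2d\<close>-th root is minus a power of the \<open>d\<close>-th one.\<close>
    have "zeta (2 * d) ^ d = cis pi" using d by (simp add: zeta_power)
    hence "zeta (2 * d) ^ (d + 1) = - zeta (2 * d)" by simp
    moreover have "zeta (2 * d) ^ (d + 1) = zeta d ^ c"
      unfolding c power_mult using zeta_mult_power[of 2 d] by simp
    ultimately have "zeta (2 * d) = - (zeta d ^ c)" by (metis minus_minus)
    thus ?thesis using l self rat_adjoin_power rat_adjoin_closed(5) by metis
  qed
  moreover obtain k where k: "lcm 2 d = k * m" using assms(2) by (metis dvd_def mult.commute)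
  have "k > 0" using k d by (metis gr0I lcm_pos_nat mult_0 less_irrefl zero_less_numeral)
  hence "zeta m = zeta (lcm 2 d) ^ k" using zeta_mult_power[of k m] k by simp
  ultimately show ?thesis using rat_adjoin_power by metis
qed

text \<open>Passing to \<open>lcm 2 d\<close>, the number of roots of unity in \<open>\<rat>(\<zeta>\<^sub>d)\<close>, absorbs the coincidence
\<open>\<rat>(\<zeta>\<^sub>d) = \<rat>(\<zeta>\<^sub>2\<^sub>d)\<close> for odd \<open>d\<close>.\<close>

lemma cyclotomic_field_eq_iff:
  assumes "m > 0" "d > 0"
  shows "rat_adjoin {zeta m} = rat_adjoin {zeta d} \<longleftrightarrow> lcm 2 m = lcm 2 d"
proof
  assume eq: "rat_adjoin {zeta m} = rat_adjoin {zeta d}"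
  have "zeta m \<in> rat_adjoin {zeta d}" "zeta d \<in> rat_adjoin {zeta m}"
    using eq rat_adjoin_closed(2) by blast+
  hence "m dvd lcm 2 d" "d dvd lcm 2 m"
    using assms zeta_in_cyclotomic_imp_dvd by blast+
  thus "lcm 2 m = lcm 2 d" by (intro dvd_antisym) auto
next
  assume eq: "lcm 2 m = lcm 2 d"
  have "m dvd lcm 2 d" "d dvd lcm 2 m" using eq by (metis dvd_lcm2)+
  thus "rat_adjoin {zeta m} = rat_adjoin {zeta d}"
    using assms by (intro equalityI rat_adjoin_subset) (auto intro: dvd_imp_zeta_in_cyclotomic)
qed

section \<open>Irreducible characters of abelian groups\<close>

definition lin_chars :: "('a, 'b) monoid_scheme \<Rightarrow> ('a \<Rightarrow> complex) set" where
  "lin_chars A = {\<chi> \<in> extensional (carrier A). (\<forall>x\<in>carrier A. \<chi> x \<noteq> 0) \<and>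
     (\<forall>x\<in>carrier A. \<forall>y\<in>carrier A. \<chi> (x \<otimes>\<^bsub>A\<^esub> y) = \<chi> x * \<chi> y)}"

lemma GL_simps:
  "monoid.mult (GL n) = (*)"
  "carrier (GL n) = {M \<in> carrier_mat n n. \<exists>N\<in>carrier_mat n n. N * M = 1\<^sub>m n \<and> M * N = 1\<^sub>m n}"
  by (auto simp: GL_def units_of_def Units_def ring_mat_simps)

lemma subspaceI_vec:
  assumes "W \<subseteq> carrier_vec n" "0\<^sub>v n \<in> W"
    and "\<And>v w. v \<in> W \<Longrightarrow> w \<in> W \<Longrightarrow> v + w \<in> W" "\<And>c v. v \<in> W \<Longrightarrow> c \<cdot>\<^sub>v v \<in> W"
  shows "VectorSpace.subspace class_ring W (module_vec TYPE(complex) n)"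
  by (intro VectorSpace.subspace.intro submodule.intro vec_vs vec_module)
     (use assms in \<open>auto simp: module_vec_simps\<close>)

text \<open>Schur's lemma: an eigenspace of \<open>\<rho> g\<close> is invariant under all \<open>\<rho> h\<close>, since they commute with
\<open>\<rho> g\<close>, so by irreducibility it is the whole space.\<close>

lemma irreducible_representation_scalar:
  fixes A :: "('a, 'b) monoid_scheme"
  assumes A: "comm_group A" and irr: "irreducible_representation A n \<rho>" and g: "g \<in> carrier A"
  obtains c where "\<rho> g = c \<cdot>\<^sub>m 1\<^sub>m n"
proof -
  interpret comm_group A by fact
  have n: "n > 0" and hom: "\<rho> \<in> hom A (GL n)"
    and irr': "\<And>W. VectorSpace.subspace class_ring W (module_vec TYPE(complex) n) \<Longrightarrow>
          (\<forall>g\<in>carrier A. \<forall>v\<in>W. \<rho> g *\<^sub>v v \<in> W) \<Longrightarrow> W = {0\<^sub>v n} \<or> W = carrier_vec n"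
    using irr by (auto simp: irreducible_representation_def)
  have \<rho>: "\<rho> h \<in> carrier_mat n n" if "h \<in> carrier A" for h
    using hom that by (auto simp: hom_def GL_simps)
  obtain c where "c \<in> spectrum (\<rho> g)" using spectrum_non_empty[OF \<rho>[OF g] n] by blast
  then obtain v where v: "v \<in> carrier_vec n" "v \<noteq> 0\<^sub>v n" "\<rho> g *\<^sub>v v = c \<cdot>\<^sub>v v"
    using \<rho>[OF g] by (auto simp: spectrum_def eigenvalue_def eigenvector_def)
  define W where "W = {v \<in> carrier_vec n. \<rho> g *\<^sub>v v = c \<cdot>\<^sub>v v}"
  have "VectorSpace.subspace class_ring W (module_vec TYPE(complex) n)"
  proof (rule subspaceI_vec)
    show "a + b \<in> W" if "a \<in> W" "b \<in> W" for a b
      using that \<rho>[OF g] by (auto simp: W_def mult_add_distrib_mat_vec smult_add_distrib_vec)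
    show "d \<cdot>\<^sub>v a \<in> W" if "a \<in> W" for d a
      using that \<rho>[OF g] by (auto simp: W_def mult_mat_vec smult_smult_assoc mult.commute)
  qed (use \<rho>[OF g] in \<open>auto simp: W_def\<close>)
  moreover have "\<rho> h *\<^sub>v w \<in> W" if h: "h \<in> carrier A" and w: "w \<in> W" for h w
  proof -
    have w': "w \<in> carrier_vec n" "\<rho> g *\<^sub>v w = c \<cdot>\<^sub>v w" using w by (auto simp: W_def)
    have "\<rho> g * \<rho> h = \<rho> (g \<otimes>\<^bsub>A\<^esub> h)" using hom g h by (auto simp: hom_def GL_simps)
    also have "\<dots> = \<rho> (h \<otimes>\<^bsub>A\<^esub> g)" using g h by (simp add: m_comm)
    also have "\<dots> = \<rho> h * \<rho> g" using hom g h by (auto simp: hom_def GL_simps)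
    finally have comm: "\<rho> g * \<rho> h = \<rho> h * \<rho> g" .
    have "\<rho> g *\<^sub>v (\<rho> h *\<^sub>v w) = (\<rho> g * \<rho> h) *\<^sub>v w"
      by (rule assoc_mult_mat_vec[symmetric, OF \<rho>[OF g] \<rho>[OF h] w'(1)])
    also have "\<dots> = \<rho> h *\<^sub>v (\<rho> g *\<^sub>v w)"
      unfolding comm by (rule assoc_mult_mat_vec[OF \<rho>[OF h] \<rho>[OF g] w'(1)])
    also have "\<dots> = c \<cdot>\<^sub>v (\<rho> h *\<^sub>v w)"
      unfolding w'(2) by (rule mult_mat_vec[OF \<rho>[OF h] w'(1)])
    finally show ?thesis using \<rho>[OF h] w'(1) by (simp add: W_def)
  qed
  ultimately have "W = {0\<^sub>v n} \<or> W = carrier_vec n" by (intro irr') auto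
  moreover have "v \<in> W" using v by (simp add: W_def)
  ultimately have W: "W = carrier_vec n" using v by auto
  have "\<rho> g = c \<cdot>\<^sub>m 1\<^sub>m n"
  proof (rule eq_matI)
    fix i j assume "i < dim_row (c \<cdot>\<^sub>m 1\<^sub>m n :: complex mat)" "j < dim_col (c \<cdot>\<^sub>m 1\<^sub>m n :: complex mat)"
    hence ij: "i < n" "j < n" by auto
    have "unit_vec n j \<in> W" using W by simp
    hence "(\<rho> g *\<^sub>v unit_vec n j) $ i = (c \<cdot>\<^sub>v unit_vec n j) $ i" by (simp add: W_def)
    thus "\<rho> g $$ (i, j) = (c \<cdot>\<^sub>m 1\<^sub>m n) $$ (i, j)"
      using ij \<rho>[OF g] by (auto simp: scalar_prod_right_unit)
  qed (use \<rho>[OF g] in auto)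
  thus thesis by (rule that)
qed

text \<open>As all \<open>\<rho> g\<close> are scalar, the line spanned by the first unit vector is invariant.\<close>

lemma irreducible_representation_degree_1:
  fixes A :: "('a, 'b) monoid_scheme"
  assumes A: "comm_group A" and irr: "irreducible_representation A n \<rho>"
  shows "n = 1"
proof (rule ccontr)
  assume n1: "n \<noteq> 1"
  have n: "n > 1" using irr n1 by (auto simp: irreducible_representation_def)
  define W where "W = {v \<in> carrier_vec n. \<forall>i<n. i \<noteq> 0 \<longrightarrow> v $ i = (0 :: complex)}"
  have "VectorSpace.subspace class_ring W (module_vec TYPE(complex) n)"
    by (rule subspaceI_vec) (auto simp: W_def)
  moreover have "\<rho> g *\<^sub>v v \<in> W" if g: "g \<in> carrier A" and v: "v \<in> W" for g v
  proof -
    obtain c where c: "\<rho> g = c \<cdot>\<^sub>m 1\<^sub>m n"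
      using irreducible_representation_scalar[OF A irr g] by blast
    have "\<rho> g *\<^sub>v v = c \<cdot>\<^sub>v v" using v unfolding c W_def by auto
    thus ?thesis using v by (auto simp: W_def)
  qed
  ultimately have "W = {0\<^sub>v n} \<or> W = carrier_vec n"
    using irr by (auto simp: irreducible_representation_def)
  moreover have "unit_vec n 0 \<in> W" using n by (auto simp: W_def)
  moreover have "unit_vec n 0 \<noteq> (0\<^sub>v n :: complex vec)"
    using n by (simp add: unit_vec_nonzero)
  moreover have "unit_vec n 1 \<notin> W" "unit_vec n 1 \<in> (carrier_vec n :: complex vec set)"
    using n by (auto simp: W_def)
  ultimately show False by blast
qed

lemma Irr_eq_lin_chars:
  fixes A :: "('a, 'b) monoid_scheme"
  assumes A: "comm_group A"
  shows "Irr A = lin_chars A"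
proof (intro equalityI subsetI)
  interpret comm_group A by fact
  fix \<chi> assume "\<chi> \<in> Irr A"
  then obtain n \<rho> where irr: "irreducible_representation A n \<rho>"
    and \<chi>: "\<chi> = (\<lambda>g\<in>carrier A. mat_trace (\<rho> g))" by (auto simp: Irr_def)
  have n: "n = 1" using irreducible_representation_degree_1[OF A irr] .
  have hom: "\<rho> \<in> hom A (GL 1)" using irr n by (auto simp: irreducible_representation_def)
  have entry: "(M * N) $$ (0, 0) = M $$ (0, 0) * N $$ (0, 0)"
    if "M \<in> carrier_mat 1 1" "N \<in> carrier_mat 1 1" for M N :: "complex mat"
    using that by (auto simp: scalar_prod_def)
  have \<rho>: "\<rho> g \<in> carrier_mat 1 1" if "g \<in> carrier A" for g
    using hom that by (auto simp: hom_def GL_simps)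
  have \<chi>': "\<chi> g = \<rho> g $$ (0, 0)" if "g \<in> carrier A" for g
    using \<rho>[OF that] that by (simp add: \<chi> mat_trace_def)
  have "\<chi> g \<noteq> 0" if g: "g \<in> carrier A" for g
  proof -
    obtain N where N: "N \<in> carrier_mat 1 1" "\<rho> g * N = 1\<^sub>m 1"
      using hom_in_carrier[OF hom g] by (auto simp: GL_simps)
    have "\<chi> g * N $$ (0, 0) = (\<rho> g * N) $$ (0, 0)"
      using entry[OF \<rho>[OF g] N(1)] \<chi>'[OF g] by simp
    thus ?thesis using N(2) by auto
  qed
  moreover have "\<chi> (g \<otimes>\<^bsub>A\<^esub> h) = \<chi> g * \<chi> h" if "g \<in> carrier A" "h \<in> carrier A" for g h
  proof -
    have "\<rho> (g \<otimes>\<^bsub>A\<^esub> h) = \<rho> g * \<rho> h" using hom that by (auto simp: hom_def GL_simps)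
    thus ?thesis using that entry[OF \<rho> \<rho>] by (simp add: \<chi>')
  qed
  moreover have "\<chi> \<in> extensional (carrier A)" by (simp add: \<chi>)
  ultimately show "\<chi> \<in> lin_chars A" by (simp add: lin_chars_def)
next
  interpret comm_group A by fact
  fix \<chi> assume \<chi>: "\<chi> \<in> lin_chars A"
  define \<rho> where "\<rho> g = mat 1 1 (\<lambda>_. \<chi> g)" for g
  have "\<rho> \<in> hom A (GL 1)"
  proof (rule homI)
    fix g assume g: "g \<in> carrier A"
    have "mat 1 1 (\<lambda>_. inverse (\<chi> g)) * \<rho> g = 1\<^sub>m 1" "\<rho> g * mat 1 1 (\<lambda>_. inverse (\<chi> g)) = 1\<^sub>m 1"
      using \<chi> g by (auto simp: \<rho>_def lin_chars_def scalar_prod_def intro!: eq_matI)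
    thus "\<rho> g \<in> carrier (GL 1)" unfolding GL_simps
      by (auto simp: \<rho>_def intro!: bexI[of _ "mat 1 1 (\<lambda>_. inverse (\<chi> g))"])
  next
    fix g h assume "g \<in> carrier A" "h \<in> carrier A"
    thus "\<rho> (g \<otimes>\<^bsub>A\<^esub> h) = \<rho> g \<otimes>\<^bsub>GL 1\<^esub> \<rho> h"
      using \<chi> by (auto simp: GL_simps \<rho>_def lin_chars_def scalar_prod_def intro!: eq_matI)
  qed
  moreover have "W = {0\<^sub>v 1} \<or> W = carrier_vec 1"
    if "VectorSpace.subspace class_ring W (module_vec TYPE(complex) 1)" for W
  proof (cases "W \<subseteq> {0\<^sub>v 1}")
    case True
    have "submodule class_ring W (module_vec TYPE(complex) 1)"
      using that by (simp add: VectorSpace.subspace_def)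
    hence "0\<^sub>v 1 \<in> W" by (metis submodule.zero_closed module_vec_simps(2))
    thus ?thesis using True by auto
  next
    case False
    have sub: "submodule class_ring W (module_vec TYPE(complex) 1)"
      using that by (simp add: VectorSpace.subspace_def)
    have W: "W \<subseteq> carrier_vec 1" using submodule.subset[OF sub] by (simp add: module_vec_simps)
    obtain v where v: "v \<in> W" "v \<noteq> 0\<^sub>v 1" using False by auto
    have v1: "v \<in> carrier_vec 1" using v W by auto
    have "v $ 0 \<noteq> 0"
    proof
      assume "v $ 0 = 0"
      hence "v = 0\<^sub>v 1" using v1 by (intro eq_vecI) auto
      thus False using v by simp
    qed
    have "w \<in> W" if w: "w \<in> carrier_vec 1" for w
    proof -
      have "w = (w $ 0 / v $ 0) \<cdot>\<^sub>v v" using w v1 \<open>v $ 0 \<noteq> 0\<close> by (intro eq_vecI) auto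
      moreover have "(w $ 0 / v $ 0) \<cdot>\<^sub>v v \<in> W"
        using submodule.smult_closed[OF sub, of "w $ 0 / v $ 0" v] v by (simp add: module_vec_simps)
      ultimately show ?thesis by simp
    qed
    thus ?thesis using W by auto
  qed
  ultimately have "irreducible_representation A 1 \<rho>"
    by (auto simp: irreducible_representation_def)
  moreover have "\<chi> = (\<lambda>g\<in>carrier A. mat_trace (\<rho> g))"
    using \<chi> by (auto simp: lin_chars_def \<rho>_def mat_trace_def extensional_def)
  ultimately show "\<chi> \<in> Irr A" unfolding Irr_def by blast
qed

section \<open>Orders and fields of linear characters\<close>

text \<open>The image of a linear character is a finite subgroup of \<open>\<complex> - {0}\<close>, hence cyclic, so its cardinality is the
order of the character in the dual group.\<close>

definition char_order :: "('a, 'b) monoid_scheme \<Rightarrow> ('a \<Rightarrow> complex) \<Rightarrow> nat" where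
  "char_order A \<chi> = card (\<chi> ` carrier A)"

lemma lin_charsD:
  assumes "\<chi> \<in> lin_chars A"
  shows "\<chi> \<in> extensional (carrier A)"
    "x \<in> carrier A \<Longrightarrow> \<chi> x \<noteq> 0"
    "x \<in> carrier A \<Longrightarrow> y \<in> carrier A \<Longrightarrow> \<chi> (x \<otimes>\<^bsub>A\<^esub> y) = \<chi> x * \<chi> y"
  using assms by (auto simp: lin_chars_def)

lemma (in monoid) lin_char_one: "\<chi> \<in> lin_chars G \<Longrightarrow> \<chi> \<one> = 1"
  using lin_charsD(3)[of \<chi> G \<one> \<one>] lin_charsD(2)[of \<chi> G \<one>] by simp

lemma (in monoid) lin_char_pow:
  "\<chi> \<in> lin_chars G \<Longrightarrow> x \<in> carrier G \<Longrightarrow> \<chi> (x [^] (k::nat)) = \<chi> x ^ k"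
  by (induction k) (auto simp: lin_char_one lin_charsD(3))

lemma (in group) lin_char_image:
  assumes fin: "finite (carrier G)" and \<chi>: "\<chi> \<in> lin_chars G"
  shows "char_order G \<chi> > 0" "\<chi> ` carrier G = {z. z ^ char_order G \<chi> = 1}"
proof -
  let ?R = "\<chi> ` carrier G"
  define m where "m = char_order G \<chi>"
  have finR: "finite ?R" using fin by simp
  have m: "m = card ?R" by (simp add: m_def char_order_def)
  have m0: "m > 0" unfolding m using finR one_closed card_gt_0_iff by blast
  have "z ^ m = 1" if z: "z \<in> ?R" for z
  proof -
    obtain x where x: "x \<in> carrier G" "z = \<chi> x" using z by auto
    have z0: "z \<noteq> 0" using lin_charsD(2)[OF \<chi>] x by simp
    have inj: "inj_on ((*) z) ?R" using z0 by (auto simp: inj_on_def)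
    have "(*) z ` ?R \<subseteq> ?R"
    proof safe
      fix y assume y: "y \<in> carrier G"
      have "z * \<chi> y = \<chi> (x \<otimes> y)" using lin_charsD(3)[OF \<chi>] x y by simp
      thus "z * \<chi> y \<in> ?R" using x y by auto
    qed
    hence im: "(*) z ` ?R = ?R" using finR inj by (simp add: endo_inj_surj)
    \<comment> \<open>Multiplication by \<open>z\<close> permutes the image; comparing products over it gives \<open>z\<^sup>m = 1\<close>.\<close>
    have "\<Prod>?R = (\<Prod>w\<in>(*) z ` ?R. w)" by (simp only: im)
    also have "\<dots> = (\<Prod>w\<in>?R. z * w)" by (subst prod.reindex[OF inj]) simp
    also have "\<dots> = z ^ m * \<Prod>?R" by (simp add: prod.distrib m)
    finally have "\<Prod>?R = z ^ m * \<Prod>?R" .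
    moreover have "\<Prod>?R \<noteq> 0" using finR lin_charsD(2)[OF \<chi>] by auto
    ultimately show ?thesis by simp
  qed
  hence "?R \<subseteq> {z. z ^ m = 1}" by auto
  moreover have "finite {z :: complex. z ^ m = 1}" using m0 by (intro finite_roots_unity) auto
  moreover have "card ?R = card {z :: complex. z ^ m = 1}"
    using m card_roots_unity_eq[OF m0] by simp
  ultimately have "?R = {z. z ^ m = 1}" by (intro card_subset_eq)
  thus "char_order G \<chi> > 0" "?R = {z. z ^ char_order G \<chi> = 1}" using m0 by (simp_all add: m_def)
qed

text \<open>The image contains a primitive root of unity of order \<open>char_order G \<chi>\<close>.\<close>

lemma (in group) char_order_dvd_iff:
  assumes fin: "finite (carrier G)" and \<chi>: "\<chi> \<in> lin_chars G"
  shows "char_order G \<chi> dvd k \<longleftrightarrow> (\<forall>x\<in>carrier G. \<chi> x ^ k = 1)"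
proof
  note im = lin_char_image[OF fin \<chi>]
  show "\<forall>x\<in>carrier G. \<chi> x ^ k = 1" if "char_order G \<chi> dvd k"
  proof
    fix x assume "x \<in> carrier G"
    hence "\<chi> x ^ char_order G \<chi> = 1" using im(2) by blast
    thus "\<chi> x ^ k = 1" using that by (auto simp: dvd_def power_mult)
  qed
  assume k: "\<forall>x\<in>carrier G. \<chi> x ^ k = 1"
  have "zeta (char_order G \<chi>) \<in> \<chi> ` carrier G"
    unfolding im(2) using zeta_power_self[OF im(1)] by simp
  hence "zeta (char_order G \<chi>) ^ k = 1" using k by auto
  thus "char_order G \<chi> dvd k" using zeta_power_eq_1_iff[OF im(1)] by simp
qed

lemma (in group) char_order_dvd_order:
  assumes fin: "finite (carrier G)" and \<chi>: "\<chi> \<in> lin_chars G"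
  shows "char_order G \<chi> dvd Coset.order G"
  using pow_order_eq_1 lin_char_pow[OF \<chi>] lin_char_one[OF \<chi>]
  by (subst char_order_dvd_iff[OF fin \<chi>]) metis

lemma (in group) character_field_lin_char:
  assumes fin: "finite (carrier G)" and \<chi>: "\<chi> \<in> lin_chars G"
  shows "character_field G \<chi> = rat_adjoin {zeta (char_order G \<chi>)}"
proof -
  define m where "m = char_order G \<chi>"
  have m0: "m > 0" and im: "\<chi> ` carrier G = {z. z ^ m = 1}"
    using lin_char_image[OF fin \<chi>] by (simp_all add: m_def)
  have "{z. z ^ m = 1} = (\<lambda>k. zeta m ^ k) ` {..<m}"
    using bij_betw_roots_unity[OF m0] by (simp add: bij_betw_def zeta_power)
  hence "{z. z ^ m = 1} \<subseteq> rat_adjoin {zeta m}"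
    by (auto intro: rat_adjoin_power rat_adjoin_closed(2))
  moreover have "{zeta m} \<subseteq> rat_adjoin {z. z ^ m = 1}"
    using zeta_power_self[OF m0] by (auto intro: rat_adjoin_closed(2))
  ultimately show ?thesis
    unfolding character_field_def im m_def[symmetric] by (intro equalityI rat_adjoin_subset)
qed

lemma (in comm_group) I_chars_eq:
  assumes fin: "finite (carrier G)" and d: "d > 0"
  shows "I_chars d G = {\<chi> \<in> lin_chars G. lcm 2 (char_order G \<chi>) = lcm 2 d}"
proof -
  have "comm_group G" by unfold_locales
  thus ?thesis
    using character_field_lin_char[OF fin] cyclotomic_field_eq_iff[OF lin_char_image(1)[OF fin] d]
    by (auto simp: I_chars_def Irr_eq_lin_chars)
qed

lemma (in group) finite_lin_chars:
  assumes fin: "finite (carrier G)" shows "finite (lin_chars G)"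
proof (rule finite_subset)
  show "lin_chars G \<subseteq> PiE (carrier G) (\<lambda>_. {z. z ^ Coset.order G = 1})"
  proof
    fix \<chi> assume \<chi>: "\<chi> \<in> lin_chars G"
    have "\<chi> x ^ Coset.order G = 1" if "x \<in> carrier G" for x
      using char_order_dvd_order[OF fin \<chi>] char_order_dvd_iff[OF fin \<chi>] that by blast
    thus "\<chi> \<in> PiE (carrier G) (\<lambda>_. {z. z ^ Coset.order G = 1})"
      using lin_charsD(1)[OF \<chi>] by (auto simp: PiE_iff)
  qed
  have "Coset.order G > 0" using fin order_gt_0_iff_finite by simp
  thus "finite (PiE (carrier G) (\<lambda>_. {z :: complex. z ^ Coset.order G = 1}))"
    using fin by (intro finite_PiE finite_roots_unity) auto
qed

text \<open>The \<open>k\<close>-torsion of the dual group. Unlike the set of characters of exact order \<open>k\<close>, it is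
multiplicative over direct sums.\<close>

definition torsion_chars :: "('a, 'b) monoid_scheme \<Rightarrow> nat \<Rightarrow> ('a \<Rightarrow> complex) set" where
  "torsion_chars A k = {\<chi> \<in> lin_chars A. \<forall>x\<in>carrier A. \<chi> x ^ k = 1}"

lemma torsion_chars_iso_le:
  assumes "group A" "finite (carrier A)" and \<phi>: "\<phi> \<in> iso A B"
  shows "card (torsion_chars B k) \<le> card (torsion_chars A k)"
proof (rule card_inj_on_le)
  interpret group A by fact
  have bij: "bij_betw \<phi> (carrier A) (carrier B)" and hom: "\<phi> \<in> hom A B"
    using \<phi> by (auto simp: iso_def)
  let ?f = "\<lambda>\<chi>. restrict (\<chi> \<circ> \<phi>) (carrier A)"
  show "inj_on ?f (torsion_chars B k)"
  proof (rule inj_onI)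
    fix \<chi> \<psi> assume *: "\<chi> \<in> torsion_chars B k" "\<psi> \<in> torsion_chars B k" "?f \<chi> = ?f \<psi>"
    show "\<chi> = \<psi>"
    proof (rule extensionalityI)
      show "\<chi> \<in> extensional (carrier B)" "\<psi> \<in> extensional (carrier B)"
        using * by (auto simp: torsion_chars_def lin_chars_def)
      fix y assume "y \<in> carrier B"
      then obtain x where x: "x \<in> carrier A" "y = \<phi> x" using bij by (auto simp: bij_betw_def)
      have "?f \<chi> x = ?f \<psi> x" using *(3) by simp
      thus "\<chi> y = \<psi> y" using x by simp
    qed
  qed
  show "?f ` torsion_chars B k \<subseteq> torsion_chars A k"
    using hom by (auto simp: torsion_chars_def lin_chars_def hom_def Pi_def)
  show "finite (torsion_chars A k)"
    using finite_lin_chars assms(2) by (auto simp: torsion_chars_def)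
qed

lemma torsion_chars_iso:
  assumes "group A" "group B" "finite (carrier A)" "A \<cong> B"
  shows "card (torsion_chars A k) = card (torsion_chars B k)"
proof -
  have "B \<cong> A" using assms group.iso_sym by blast
  moreover have "finite (carrier B)" using assms iso_finite by blast
  ultimately show ?thesis using assms torsion_chars_iso_le
    by (metis (no_types, lifting) antisym equals0I is_iso_def)
qed

section \<open>Characters of direct sums of cyclic groups\<close>

lemma card_roots_of_unity_inter:
  assumes "q > 0"
  shows "card {z :: complex. z ^ q = 1 \<and> z ^ k = 1} = gcd q k"
proof -
  have "z ^ q = 1 \<and> z ^ k = 1 \<longleftrightarrow> z ^ gcd q k = 1" for z :: complex
  proof
    assume z: "z ^ q = 1 \<and> z ^ k = 1"
    obtain x y where xy: "q * x = k * y + gcd q k" using bezout_nat[of q k] assms by auto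
    have "(z ^ q) ^ x = (z ^ k) ^ y * z ^ gcd q k"
      by (simp add: xy flip: power_mult power_add)
    thus "z ^ gcd q k = 1" using z by simp
  next
    assume z: "z ^ gcd q k = 1"
    have "z ^ j = 1" if "gcd q k dvd j" for j using that z by (auto simp: dvd_def power_mult)
    thus "z ^ q = 1 \<and> z ^ k = 1" by simp
  qed
  thus ?thesis using card_roots_unity_eq[of "gcd q k"] assms by simp
qed

lemma root_of_unity_power_mod:
  assumes "(z :: complex) ^ q = 1" shows "z ^ (k mod q) = z ^ k"
proof -
  have "z ^ k = z ^ (q * (k div q) + k mod q)" by simp
  thus ?thesis by (simp only: power_add power_mult assms power_one mult_1_left)
qed

text \<open>A character is determined by its values on the generators \<open>s j 1\<close> of the summands, and these values
can be prescribed freely among the roots of unity of order dividing both \<open>q j\<close> and \<open>k\<close>.\<close>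

lemma card_torsion_chars_sum_group:
  fixes q :: "nat \<Rightarrow> nat"
  assumes I: "finite I" and q: "\<And>j. j \<in> I \<Longrightarrow> q j > 0"
  shows "card (torsion_chars (sum_group I (\<lambda>j. integer_mod_group (q j))) k) = (\<Prod>j\<in>I. gcd (q j) k)"
proof -
  define A where "A = sum_group I (\<lambda>j. integer_mod_group (q j))"
  interpret group A by (simp add: A_def)
  have carr: "carrier A = PiE I (\<lambda>j. {0..<int (q j)})"
  proof -
    have "carrier A = PiE I (\<lambda>j. carrier (integer_mod_group (q j)))"
      using I by (auto simp: A_def carrier_sum_group)
    also have "\<dots> = PiE I (\<lambda>j. {0..<int (q j)})"
      using q by (intro PiE_cong) (simp add: carrier_integer_mod_group)
    finally show ?thesis .
  qed
  have mult: "x \<otimes>\<^bsub>A\<^esub> y = (\<lambda>i\<in>I. (x i + y i) mod int (q i))" for x y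
    by (simp add: A_def)
  have one: "\<one>\<^bsub>A\<^esub> = (\<lambda>i\<in>I. 0)" by (simp add: A_def)
  \<comment> \<open>\<open>s j m\<close> is \<open>m\<close> times the generator of the \<open>j\<close>-th summand; reducing \<open>m\<close> modulo \<open>q j\<close> covers \<open>q j = 1\<close>.\<close>
  define s where "s j m = (\<lambda>i\<in>I. if i = j then int m mod int (q i) else 0)" for j m
  have s_in: "s j m \<in> carrier A" for j m using q by (auto simp: carr s_def PiE_iff)
  have s_pow: "\<chi> (s j m) = \<chi> (s j 1) ^ m" if \<chi>: "\<chi> \<in> lin_chars A" for \<chi> j m
  proof (induction m)
    case 0
    have "s j 0 = \<one>\<^bsub>A\<^esub>" by (auto simp: s_def one)
    thus ?case using lin_char_one[OF \<chi>] by simp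
  next
    case (Suc m)
    have "s j (Suc m) = s j m \<otimes>\<^bsub>A\<^esub> s j 1"
      unfolding s_def mult by (intro restrict_ext) (simp add: mod_add_eq add.commute[of 1])
    thus ?case using lin_charsD(3)[OF \<chi> s_in s_in] Suc.IH by simp
  qed
  have expand: "\<chi> f = (\<Prod>j\<in>I. \<chi> (s j 1) ^ nat (f j))" if \<chi>: "\<chi> \<in> lin_chars A" and f: "f \<in> carrier A" for \<chi> f
  proof -
    \<comment> \<open>Induction on the set \<open>J\<close> of coordinates that are kept.\<close>
    have "\<chi> (\<lambda>i\<in>I. if i \<in> J then f i else 0) = (\<Prod>j\<in>J. \<chi> (s j 1) ^ nat (f j))"
      if "finite J" "J \<subseteq> I" for J
      using that
    proof (induction J rule: finite_induct)
      case empty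
      have "(\<lambda>i\<in>I. 0) = \<one>\<^bsub>A\<^esub>" by (simp add: one)
      thus ?case using lin_char_one[OF \<chi>] by simp
    next
      case (insert j J)
      have j: "j \<in> I" using insert by simp
      let ?f = "\<lambda>i\<in>I. if i \<in> J then f i else 0"
      have f': "f i \<in> {0..<int (q i)}" if "i \<in> I" for i using f that by (auto simp: carr)
      have fJ: "?f \<in> carrier A" using f' q by (auto simp: carr)
      have "(\<lambda>i\<in>I. if i \<in> insert j J then f i else 0) = s j (nat (f j)) \<otimes>\<^bsub>A\<^esub> ?f"
        using f' insert by (auto simp: mult s_def)
      hence "\<chi> (\<lambda>i\<in>I. if i \<in> insert j J then f i else 0) = \<chi> (s j (nat (f j))) * \<chi> ?f"
        using lin_charsD(3)[OF \<chi> s_in fJ] by (simp only:)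
      also have "\<dots> = \<chi> (s j 1) ^ nat (f j) * (\<Prod>i\<in>J. \<chi> (s i 1) ^ nat (f i))"
        using insert.IH insert.prems s_pow[OF \<chi>, of j "nat (f j)"] by (simp only: insert_subset)
      also have "\<dots> = (\<Prod>i\<in>insert j J. \<chi> (s i 1) ^ nat (f i))" using insert.hyps by simp
      finally show ?case .
    qed
    note step = this[OF I subset_refl]
    have "(\<lambda>i\<in>I. if i \<in> I then f i else 0) = f"
      using f by (auto simp: carr PiE_iff extensional_def)
    with step show ?thesis by (simp only:)
  qed
  let ?Z = "PiE I (\<lambda>j. {z :: complex. z ^ q j = 1 \<and> z ^ k = 1})"
  let ?F = "\<lambda>\<chi>. \<lambda>j\<in>I. \<chi> (s j 1)"
  let ?H = "\<lambda>z. \<lambda>f\<in>carrier A. \<Prod>j\<in>I. z j ^ nat (f j)"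
  have "bij_betw ?F (torsion_chars A k) ?Z"
  proof (rule bij_betw_byWitness[where f' = ?H])
    show "\<forall>\<chi>\<in>torsion_chars A k. ?H (?F \<chi>) = \<chi>"
    proof
      fix \<chi> assume "\<chi> \<in> torsion_chars A k"
      hence \<chi>: "\<chi> \<in> lin_chars A" by (simp add: torsion_chars_def)
      show "?H (?F \<chi>) = \<chi>"
        by (rule extensionalityI[of _ "carrier A"]) (auto simp: expand[OF \<chi>] lin_charsD(1)[OF \<chi>])
    qed
    show "\<forall>z\<in>?Z. ?F (?H z) = z"
    proof
      fix z assume z: "z \<in> ?Z"
      show "?F (?H z) = z"
      proof (rule extensionalityI[of _ I])
        fix j assume j: "j \<in> I"
        have "(\<Prod>i\<in>I. z i ^ nat (s j 1 i)) = (\<Prod>i\<in>I. if i = j then z j ^ (1 mod q j) else 1)"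
          by (intro prod.cong) (auto simp: s_def nat_mod_distrib)
        also have "\<dots> = z j ^ (1 mod q j)" using I j by simp
        also have "\<dots> = z j"
        proof -
          have "z j ^ q j = 1" using z j by (auto simp: PiE_iff)
          from root_of_unity_power_mod[OF this, of 1] show ?thesis by (simp only: power_one_right)
        qed
        finally show "?F (?H z) j = z j" using j s_in by simp
      qed (use z in \<open>auto simp: PiE_iff\<close>)
    qed
    show "?F ` torsion_chars A k \<subseteq> ?Z"
    proof (safe intro!: PiE_I)
      fix \<chi> j assume "\<chi> \<in> torsion_chars A k" and j: "j \<in> I"
      hence \<chi>: "\<chi> \<in> lin_chars A" and tor: "\<And>x. x \<in> carrier A \<Longrightarrow> \<chi> x ^ k = 1"
        by (auto simp: torsion_chars_def)
      have "s j (q j) = \<one>\<^bsub>A\<^esub>" by (auto simp: s_def one)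
      hence "\<chi> (s j 1) ^ q j = 1" using s_pow[OF \<chi>, of j "q j"] lin_char_one[OF \<chi>] by simp
      thus "?F \<chi> j ^ q j = 1" "?F \<chi> j ^ k = 1" using j tor[OF s_in] by simp_all
    qed simp
    show "?H ` ?Z \<subseteq> torsion_chars A k"
    proof safe
      fix z assume z: "z \<in> ?Z"
      have zq: "z j ^ q j = 1" "z j ^ k = 1" if "j \<in> I" for j using z that by (auto simp: PiE_iff)
      have z0: "z j \<noteq> 0" if "j \<in> I" for j using zq(1)[OF that] q[OF that] by (auto simp: power_0_left)
      have "?H z (x \<otimes>\<^bsub>A\<^esub> y) = ?H z x * ?H z y" if xy: "x \<in> carrier A" "y \<in> carrier A" for x y
      proof -
        have "z j ^ nat ((x j + y j) mod int (q j)) = z j ^ nat (x j) * z j ^ nat (y j)" if j: "j \<in> I" for j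
        proof -
          have "x j \<ge> 0" "y j \<ge> 0" using xy j by (auto simp: carr)
          hence "nat ((x j + y j) mod int (q j)) = (nat (x j) + nat (y j)) mod q j"
            by (simp add: nat_mod_distrib nat_add_distrib)
          thus ?thesis using root_of_unity_power_mod[OF zq(1)[OF j]] by (simp add: power_add)
        qed
        moreover have "x \<otimes>\<^bsub>A\<^esub> y \<in> carrier A" using xy by simp
        ultimately show ?thesis using xy by (simp add: mult prod.distrib)
      qed
      moreover have "?H z x \<noteq> 0" if "x \<in> carrier A" for x using z0 I that by simp
      moreover have "?H z x ^ k = 1" if "x \<in> carrier A" for x
      proof -
        have "(z j ^ nat (x j)) ^ k = 1" if "j \<in> I" for j
          using zq(2)[OF that] by (metis power_mult mult.commute power_one)
        thus ?thesis using that by (simp add: prod_power_distrib)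
      qed
      ultimately show "?H z \<in> torsion_chars A k"
        unfolding torsion_chars_def lin_chars_def by blast
    qed
  qed
  hence "card (torsion_chars A k) = card ?Z" by (rule bij_betw_same_card)
  also have "\<dots> = (\<Prod>j\<in>I. gcd (q j) k)"
    using I q by (simp add: card_PiE card_roots_of_unity_inter)
  finally show ?thesis by (simp add: A_def)
qed

section \<open>Restriction to the Sylow subgroups\<close>

lemma prime_multiplicity_lcm:
  fixes a b :: nat
  assumes "prime p" "a > 0" "b > 0"
  shows "multiplicity p (lcm a b) = max (multiplicity p a) (multiplicity p b)"
  using assms
  by (simp add: prime_factorization_lcm flip: count_prime_factorization_prime)

lemma prime_part_pos: "prime r \<Longrightarrow> prime_part r d > 0"
  by (simp add: prime_part_def prime_gt_0_nat)

lemma multiplicity_prime_part: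
  "prime p \<Longrightarrow> prime r \<Longrightarrow> multiplicity p (prime_part r d) = (if p = r then multiplicity p d else 0)"
  by (auto simp: prime_part_def multiplicity_distinct_prime_power)

text \<open>Both sides compare the exponents of every prime, except that the exponents 0 and 1 of the prime 2 are
identified.\<close>

lemma lcm_2_eq_iff_prime_parts:
  fixes N m d :: nat
  assumes "N > 0" "m dvd N" "d dvd N" and P: "P = {r. prime r \<and> r dvd N}"
  shows "lcm 2 m = lcm 2 d \<longleftrightarrow> (\<forall>r\<in>P. lcm 2 (prime_part r m) = lcm 2 (prime_part r d))"
proof -
  have m: "m > 0" and d: "d > 0" using assms by (auto intro: dvd_pos_nat)
  have eq_iff: "lcm 2 x = lcm 2 y \<longleftrightarrow>
      (\<forall>p. prime p \<longrightarrow> max (multiplicity p 2) (multiplicity p x) = max (multiplicity p 2) (multiplicity p y))"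
    if "x > 0" "y > 0" for x y :: nat
  proof
    assume "lcm 2 x = lcm 2 y"
    thus "\<forall>p. prime p \<longrightarrow> max (multiplicity p 2) (multiplicity p x) = max (multiplicity p 2) (multiplicity p y)"
      using that by (metis prime_multiplicity_lcm zero_less_numeral)
  next
    assume "\<forall>p. prime p \<longrightarrow> max (multiplicity p 2) (multiplicity p x) = max (multiplicity p 2) (multiplicity p y)"
    thus "lcm 2 x = lcm 2 y"
      using that by (rule_tac multiplicity_eq_nat) (simp_all add: prime_multiplicity_lcm lcm_pos_nat)
  qed
  have zero: "multiplicity p m = 0" "multiplicity p d = 0" if "prime p" "p \<notin> P" for p
    using that assms by (auto intro!: not_dvd_imp_multiplicity_0 dest: dvd_trans)
  have "(\<forall>r\<in>P. lcm 2 (prime_part r m) = lcm 2 (prime_part r d)) \<longleftrightarrow>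
     (\<forall>r\<in>P. \<forall>p. prime p \<longrightarrow>
        max (multiplicity p 2) (if p = r then multiplicity p m else 0) =
        max (multiplicity p 2) (if p = r then multiplicity p d else 0))"
    using P by (auto simp: eq_iff prime_part_pos multiplicity_prime_part)
  also have "\<dots> \<longleftrightarrow> (\<forall>p. prime p \<longrightarrow>
        max (multiplicity p 2) (multiplicity p m) = max (multiplicity p 2) (multiplicity p d))"
    (is "?L \<longleftrightarrow> ?R")
  proof
    assume L: ?L
    show ?R
    proof (intro allI impI)
      fix p :: nat assume p: "prime p"
      show "max (multiplicity p 2) (multiplicity p m) = max (multiplicity p 2) (multiplicity p d)"
        using L[rule_format, of p p] p zero[OF p] by (cases "p \<in> P") simp_all
    qed
  next
    assume R: ?R
    show ?L by (intro ballI allI impI) (use R in auto)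
  qed
  finally show ?thesis by (simp add: eq_iff[OF m d])
qed

text \<open>Lagrange's theorem in the quotient by \<open>H\<close>.\<close>

lemma (in comm_group) pow_index_in_subgroup:
  assumes H: "subgroup H G" and fin: "finite (carrier G)" and x: "x \<in> carrier G"
  shows "x [^] (Coset.order G div card H) \<in> H"
proof -
  have HG: "H \<lhd> G" by (rule subgroup_imp_normal[OF H])
  interpret N: normal H G by (rule HG)
  interpret Q: group "G Mod H" by (rule N.factorgroup_is_group)
  have cH: "card H > 0" using H fin
    by (metis card_gt_0_iff empty_iff finite_subset subgroup.one_closed subgroup.subset)
  have ord: "Coset.order (G Mod H) = Coset.order G div card H"
  proof -
    have "Coset.order G div card H = card (rcosets H)"
      using lagrange[OF H] cH by (metis nonzero_mult_div_cancel_right less_not_refl)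
    thus ?thesis by (simp add: Coset.order_def FactGroup_def)
  qed
  have hom: "(\<lambda>a. H #> a) \<in> hom G (G Mod H)" by (rule N.r_coset_hom_Mod)
  define k where "k = Coset.order G div card H"
  have "H #> (x [^] k) = (H #> x) [^]\<^bsub>G Mod H\<^esub> k"
    by (rule hom_nat_pow[OF hom x is_group Q.is_group])
  also have "\<dots> = \<one>\<^bsub>G Mod H\<^esub>"
    using Q.pow_order_eq_1[of "H #> x"] hom x by (auto simp: hom_def k_def ord)
  finally have "H #> (x [^] k) = H" by (simp add: FactGroup_def)
  thus ?thesis using coset_join1[OF _ _ H] x by (simp add: k_def)
qed

lemma restrict_lin_char:
  assumes "subgroup K A" "\<chi> \<in> lin_chars A"
  shows "restrict \<chi> K \<in> lin_chars (A\<lparr>carrier := K\<rparr>)"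
  using assms subgroup.subset[OF assms(1)] subgroup.m_closed[OF assms(1)]
  by (auto simp: lin_chars_def subset_iff)

locale abelian_sylow_family = comm_group G for G :: "('a, 'b) monoid_scheme" (structure) +
  fixes S :: "nat \<Rightarrow> 'a set" and P :: "nat set"
  assumes fin: "finite (carrier G)"
    and P_def: "P = {r. prime r \<and> r dvd Coset.order G}"
    and sylow: "r \<in> P \<Longrightarrow> sylow_subgroup G r (S r)"
begin

abbreviation "N \<equiv> Coset.order G"

abbreviation "H r \<equiv> G\<lparr>carrier := S r\<rparr>"

lemma N_pos: "N > 0"
  using fin order_gt_0_iff_finite by simp

lemma P_prime: "r \<in> P \<Longrightarrow> prime r"
  by (simp add: P_def)

lemma P_prime_factors: "P = prime_factors N"
  using N_pos by (auto simp: P_def prime_factors_dvd)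

lemma finite_P: "finite P"
  by (simp add: P_prime_factors)

lemma subgroup_S: "r \<in> P \<Longrightarrow> subgroup (S r) G"
  using sylow by (simp add: sylow_subgroup_def)

lemma card_S: "r \<in> P \<Longrightarrow> card (S r) = prime_part r N"
  using sylow by (simp add: sylow_subgroup_def)

lemma S_subset: "r \<in> P \<Longrightarrow> S r \<subseteq> carrier G"
  using subgroup_S subgroup.subset by blast

lemma finite_S: "r \<in> P \<Longrightarrow> finite (S r)"
  using S_subset fin finite_subset by blast

lemma comm_group_H: "r \<in> P \<Longrightarrow> comm_group (H r)"
  using subgroup_S S_subset m_comm subgroup_imp_group
  by (intro group.group_comm_groupI) (auto simp: subset_iff)

lemma N_split: "r \<in> P \<Longrightarrow> N = prime_part r N * (N div prime_part r N)"
  by (simp add: prime_part_def multiplicity_dvd)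

lemma coprime_prime_part: "r \<in> P \<Longrightarrow> coprime (prime_part r N) (N div prime_part r N)"
proof -
  assume r: "r \<in> P"
  have "\<not> r dvd N div r ^ multiplicity r N"
    using multiplicity_decompose[of N r] N_pos prime_gt_1_nat[OF P_prime[OF r]] by simp
  thus ?thesis unfolding prime_part_def using P_prime[OF r]
    by (simp add: prime_imp_coprime)
qed

lemma coprime_prime_parts:
  assumes "r \<in> P" "s \<in> P" "r \<noteq> s"
  shows "coprime (prime_part r N) (prime_part s N)"
proof -
  have "coprime r s" using assms P_prime primes_coprime by blast
  thus ?thesis by (simp add: prime_part_def)
qed

lemma prime_part_dvd_cofactor:
  assumes "r \<in> P" "s \<in> P" "r \<noteq> s"
  shows "prime_part s N dvd N div prime_part r N"
proof -
  have "coprime (prime_part s N) (prime_part r N)"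
    using coprime_prime_parts assms by blast
  moreover have "prime_part s N dvd prime_part r N * (N div prime_part r N)"
    using N_split[OF assms(1)] by (metis multiplicity_dvd prime_part_def)
  ultimately show ?thesis by (simp add: coprime_dvd_mult_right_iff)
qed

text \<open>The exponents \<open>sylow_exponent r\<close> are the orthogonal idempotents of \<open>\<int>/N\<close>: the power map
\<open>x \<mapsto> x [^] sylow_exponent r\<close> is the projection of \<open>G\<close> onto its Sylow \<open>r\<close>-subgroup.\<close>

definition sylow_exponent :: "nat \<Rightarrow> nat" where
  "sylow_exponent r = (SOME k. [k = 1] (mod prime_part r N) \<and> [k = 0] (mod N div prime_part r N))"

lemma sylow_exponent_cong:
  assumes "r \<in> P"
  shows "[sylow_exponent r = 1] (mod prime_part r N)" "N div prime_part r N dvd sylow_exponent r"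
proof -
  have "\<exists>k. [k = 1] (mod prime_part r N) \<and> [k = 0] (mod N div prime_part r N)"
    by (rule binary_chinese_remainder_nat[OF coprime_prime_part[OF assms]])
  from someI_ex[OF this, folded sylow_exponent_def]
  show "[sylow_exponent r = 1] (mod prime_part r N)" "N div prime_part r N dvd sylow_exponent r"
    by (auto simp: cong_0_iff)
qed

lemma sum_sylow_exponent_cong: "[(\<Sum>r\<in>P. sylow_exponent r) = 1] (mod N)"
proof -
  have "[(\<Sum>r\<in>P. sylow_exponent r) = 1] (mod (\<Prod>r\<in>P. prime_part r N))"
  proof (rule coprime_cong_prod_nat)
    fix r s assume "r \<in> P" "s \<in> P" "r \<noteq> s"
    thus "coprime (prime_part r N) (prime_part s N)"
      by (rule coprime_prime_parts)
  next
    fix r assume r: "r \<in> P"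
    have "prime_part r N dvd sylow_exponent s" if "s \<in> P - {r}" for s
      using that r prime_part_dvd_cofactor[of s r] sylow_exponent_cong(2)[of s] dvd_trans by blast
    hence "prime_part r N dvd (\<Sum>s\<in>P - {r}. sylow_exponent s)" by (rule dvd_sum)
    hence "[(\<Sum>s\<in>P - {r}. sylow_exponent s) = 0] (mod prime_part r N)" by (simp add: cong_0_iff)
    with sylow_exponent_cong(1)[OF r] have "[sylow_exponent r + (\<Sum>s\<in>P - {r}. sylow_exponent s) = 1 + 0] (mod prime_part r N)"
      by (rule cong_add)
    thus "[(\<Sum>s\<in>P. sylow_exponent s) = 1] (mod prime_part r N)"
      using sum.remove[OF finite_P r, of sylow_exponent] by simp
  qed
  also have "(\<Prod>r\<in>P. prime_part r N) = N"
    using N_pos prod_prime_factors[of N] by (simp add: P_prime_factors prime_part_def)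
  finally show ?thesis .
qed

lemma pow_cong:
  assumes "x \<in> carrier G" "x [^] (k :: nat) = \<one>" "[i = j] (mod k)"
  shows "x [^] i = x [^] (j :: nat)"
proof -
  have *: "x [^] i = x [^] (i mod k)" for i :: nat
  proof -
    have "x [^] i = x [^] (k * (i div k) + i mod k)" by simp
    also have "\<dots> = (x [^] k) [^] (i div k) \<otimes> x [^] (i mod k)"
      using assms(1) by (simp only: nat_pow_mult nat_pow_pow)
    finally show ?thesis using assms by simp
  qed
  show ?thesis using *[of i] *[of j] assms(3) by (simp add: cong_def)
qed

lemma pow_card_S: "r \<in> P \<Longrightarrow> x \<in> S r \<Longrightarrow> x [^] prime_part r N = \<one>"
proof -
  assume r: "r \<in> P" and x: "x \<in> S r"
  interpret Hr: comm_group "H r" by (rule comm_group_H[OF r])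
  have "x [^]\<^bsub>H r\<^esub> Coset.order (H r) = \<one>\<^bsub>H r\<^esub>"
    using x by (intro Hr.pow_order_eq_1) simp
  thus ?thesis using card_S[OF r] by (simp add: Coset.order_def flip: nat_pow_consistent)
qed

lemma pow_sylow_exponent_in_S:
  assumes r: "r \<in> P" and x: "x \<in> carrier G"
  shows "x [^] sylow_exponent r \<in> S r"
proof -
  obtain k where k: "sylow_exponent r = N div prime_part r N * k" using sylow_exponent_cong(2)[OF r] by (rule dvdE)
  have "(x [^] k) [^] (N div card (S r)) \<in> S r"
    using pow_index_in_subgroup[OF subgroup_S[OF r] fin, of "x [^] k"] x by simp
  thus ?thesis using x card_S[OF r] by (simp add: k nat_pow_pow mult.commute)
qed

lemma pow_sylow_exponent_same:
  assumes "r \<in> P" "x \<in> S r"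
  shows "x [^] sylow_exponent r = x"
proof -
  have x: "x \<in> carrier G" using assms S_subset by blast
  have "x [^] sylow_exponent r = x [^] (1 :: nat)"
    by (rule pow_cong[OF x pow_card_S[OF assms] sylow_exponent_cong(1)[OF assms(1)]])
  thus ?thesis using x by simp
qed

lemma pow_sylow_exponent_other:
  assumes "r \<in> P" "s \<in> P" "r \<noteq> s" "x \<in> S r"
  shows "x [^] sylow_exponent s = \<one>"
proof -
  have "prime_part r N dvd sylow_exponent s"
    using prime_part_dvd_cofactor[of s r] sylow_exponent_cong(2)[of s] assms dvd_trans by blast
  hence "[sylow_exponent s = 0] (mod prime_part r N)" by (simp add: cong_0_iff)
  thus ?thesis using pow_cong[OF _ pow_card_S, of x r "sylow_exponent s" 0] assms S_subset by auto
qed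

lemma lin_char_sylow_expansion:
  assumes \<chi>: "\<chi> \<in> lin_chars G" and x: "x \<in> carrier G"
  shows "\<chi> x = (\<Prod>r\<in>P. \<chi> (x [^] sylow_exponent r))"
proof -
  have "x [^] (\<Sum>r\<in>P. sylow_exponent r) = x [^] (1 :: nat)"
    using x pow_order_eq_1 sum_sylow_exponent_cong by (intro pow_cong) auto
  hence "\<chi> x = \<chi> (x [^] (\<Sum>r\<in>P. sylow_exponent r))" using x by simp
  thus ?thesis using lin_char_pow[OF \<chi> x] by (simp add: power_sum)
qed

abbreviation sylow_restriction :: "('a \<Rightarrow> complex) \<Rightarrow> nat \<Rightarrow> 'a \<Rightarrow> complex" where
  "sylow_restriction \<chi> \<equiv> \<lambda>r\<in>P. restrict \<chi> (S r)"

text \<open>The dual group of \<open>G\<close> is the product of the dual groups of the Sylow subgroups. The inverse of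
restriction composes the given characters with the projections onto the Sylow subgroups.\<close>

lemma bij_betw_restrict_sylow:
  "bij_betw sylow_restriction (lin_chars G) (PiE P (\<lambda>r. lin_chars (H r)))"
proof (rule bij_betw_byWitness[where f' = "\<lambda>\<psi>. \<lambda>x\<in>carrier G. \<Prod>r\<in>P. \<psi> r (x [^] sylow_exponent r)"])
  show "\<forall>\<chi>\<in>lin_chars G. (\<lambda>x\<in>carrier G. \<Prod>r\<in>P. sylow_restriction \<chi> r (x [^] sylow_exponent r)) = \<chi>"
  proof
    fix \<chi> assume \<chi>: "\<chi> \<in> lin_chars G"
    show "(\<lambda>x\<in>carrier G. \<Prod>r\<in>P. sylow_restriction \<chi> r (x [^] sylow_exponent r)) = \<chi>"
    proof (rule extensionalityI[of _ "carrier G"])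
      fix x assume x: "x \<in> carrier G"
      have "(\<Prod>r\<in>P. sylow_restriction \<chi> r (x [^] sylow_exponent r)) = (\<Prod>r\<in>P. \<chi> (x [^] sylow_exponent r))"
        using pow_sylow_exponent_in_S x by (intro prod.cong) auto
      thus "(\<lambda>x\<in>carrier G. \<Prod>r\<in>P. sylow_restriction \<chi> r (x [^] sylow_exponent r)) x = \<chi> x"
        using x lin_char_sylow_expansion[OF \<chi> x] by simp
    qed (use lin_charsD(1)[OF \<chi>] in auto)
  qed
  show "\<forall>\<psi>\<in>PiE P (\<lambda>r. lin_chars (H r)).
      sylow_restriction (\<lambda>x\<in>carrier G. \<Prod>r\<in>P. \<psi> r (x [^] sylow_exponent r)) = \<psi>"
  proof
    fix \<psi> assume \<psi>: "\<psi> \<in> PiE P (\<lambda>r. lin_chars (H r))"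
    have ps: "\<psi> r \<in> lin_chars (H r)" if "r \<in> P" for r using \<psi> that by (auto simp: PiE_iff)
    show "sylow_restriction (\<lambda>x\<in>carrier G. \<Prod>r\<in>P. \<psi> r (x [^] sylow_exponent r)) = \<psi>"
    proof (rule extensionalityI[of _ P])
      fix r assume r: "r \<in> P"
      have "restrict (\<lambda>x\<in>carrier G. \<Prod>r\<in>P. \<psi> r (x [^] sylow_exponent r)) (S r) = \<psi> r"
      proof (rule extensionalityI[of _ "S r"])
        fix x assume x: "x \<in> S r"
        have "(\<Prod>s\<in>P. \<psi> s (x [^] sylow_exponent s)) = (\<Prod>s\<in>P. if s = r then \<psi> r x else 1)"
        proof (rule prod.cong)
          fix s assume s: "s \<in> P"
          interpret Hs: comm_group "H s" by (rule comm_group_H[OF s])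
          have "\<psi> s \<one> = 1" using Hs.lin_char_one[OF ps[OF s]] by simp
          thus "\<psi> s (x [^] sylow_exponent s) = (if s = r then \<psi> r x else 1)"
            using pow_sylow_exponent_same[OF r x] pow_sylow_exponent_other[OF r s _ x] by auto
        qed simp
        also have "\<dots> = \<psi> r x" using r finite_P by simp
        finally show "restrict (\<lambda>x\<in>carrier G. \<Prod>r\<in>P. \<psi> r (x [^] sylow_exponent r)) (S r) x = \<psi> r x"
          using x S_subset[OF r] by auto
      qed (use lin_charsD(1)[OF ps[OF r]] in auto)
      thus "sylow_restriction (\<lambda>x\<in>carrier G. \<Prod>r\<in>P. \<psi> r (x [^] sylow_exponent r)) r = \<psi> r" using r by simp
    qed (use \<psi> in \<open>auto simp: PiE_iff\<close>)
  qed
  show "sylow_restriction ` lin_chars G \<subseteq> PiE P (\<lambda>r. lin_chars (H r))"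
  proof (rule image_subsetI)
    fix \<chi> assume \<chi>: "\<chi> \<in> lin_chars G"
    have "restrict \<chi> (S r) \<in> lin_chars (H r)" if "r \<in> P" for r
      using restrict_lin_char[OF subgroup_S[OF that] \<chi>] .
    thus "sylow_restriction \<chi> \<in> PiE P (\<lambda>r. lin_chars (H r))" by auto
  qed
  show "(\<lambda>\<psi>. \<lambda>x\<in>carrier G. \<Prod>r\<in>P. \<psi> r (x [^] sylow_exponent r)) ` PiE P (\<lambda>r. lin_chars (H r)) \<subseteq> lin_chars G"
  proof (rule image_subsetI)
    fix \<psi> assume \<psi>: "\<psi> \<in> PiE P (\<lambda>r. lin_chars (H r))"
    have ps: "\<psi> r \<in> lin_chars (H r)" if "r \<in> P" for r using \<psi> that by (auto simp: PiE_iff)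
    let ?\<chi> = "\<lambda>x\<in>carrier G. \<Prod>r\<in>P. \<psi> r (x [^] sylow_exponent r)"
    have "?\<chi> (x \<otimes> y) = ?\<chi> x * ?\<chi> y" if xy: "x \<in> carrier G" "y \<in> carrier G" for x y
    proof -
      have "\<psi> r ((x \<otimes> y) [^] sylow_exponent r) = \<psi> r (x [^] sylow_exponent r) * \<psi> r (y [^] sylow_exponent r)" if r: "r \<in> P" for r
        using lin_charsD(3)[OF ps[OF r]] pow_sylow_exponent_in_S[OF r] xy by (simp add: nat_pow_distrib)
      thus ?thesis using xy by (simp add: prod.distrib)
    qed
    moreover have "?\<chi> x \<noteq> 0" if x: "x \<in> carrier G" for x
      using lin_charsD(2)[OF ps] pow_sylow_exponent_in_S x finite_P by simp
    ultimately show "?\<chi> \<in> lin_chars G" unfolding lin_chars_def by auto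
  qed
qed

text \<open>The orders \<open>ms s\<close> of the restrictions are prime powers that divide the order \<open>m\<close> of \<open>\<chi>\<close>, and \<open>m\<close>
divides their product; comparing exponents of \<open>r\<close> identifies \<open>ms r\<close>.\<close>

lemma char_order_restrict_sylow:
  assumes \<chi>: "\<chi> \<in> lin_chars G" and r: "r \<in> P"
  shows "char_order (H r) (restrict \<chi> (S r)) = prime_part r (char_order G \<chi>)"
proof -
  define m where "m = char_order G \<chi>"
  define ms where "ms s = char_order (H s) (restrict \<chi> (S s))" for s
  have m0: "m > 0" using lin_char_image(1)[OF fin \<chi>] by (simp add: m_def)
  have rs: "restrict \<chi> (S s) \<in> lin_chars (H s)" if "s \<in> P" for s
    using restrict_lin_char[OF subgroup_S[OF that] \<chi>] .
  have dvd_iff: "ms s dvd k \<longleftrightarrow> (\<forall>x\<in>S s. \<chi> x ^ k = 1)" if s: "s \<in> P" for s k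
  proof -
    interpret Hs: comm_group "H s" by (rule comm_group_H[OF s])
    show ?thesis using Hs.char_order_dvd_iff[OF _ rs[OF s], of k] finite_S[OF s] by (simp add: ms_def)
  qed
  have ms_m: "ms s dvd m" if s: "s \<in> P" for s
    using char_order_dvd_iff[OF fin \<chi>, of m] S_subset[OF s] by (auto simp: dvd_iff[OF s] m_def)
  have m_prod: "m dvd (\<Prod>s\<in>P. ms s)"
  proof -
    have "\<chi> x ^ (\<Prod>s\<in>P. ms s) = 1" if x: "x \<in> carrier G" for x
    proof -
      have "\<chi> (x [^] sylow_exponent s) ^ (\<Prod>s\<in>P. ms s) = 1" if s: "s \<in> P" for s
      proof -
        have "ms s dvd (\<Prod>s\<in>P. ms s)" using finite_P s by (rule dvd_prodI)
        thus ?thesis using dvd_iff[OF s] pow_sylow_exponent_in_S[OF s x] by blast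
      qed
      thus ?thesis using lin_char_sylow_expansion[OF \<chi> x] by (simp add: prod_power_distrib)
    qed
    thus ?thesis using char_order_dvd_iff[OF fin \<chi>] by (simp add: m_def)
  qed
  have "\<exists>i. ms s = s ^ i" if s: "s \<in> P" for s
  proof -
    interpret Hs: comm_group "H s" by (rule comm_group_H[OF s])
    have "ms s dvd Coset.order (H s)"
      using Hs.char_order_dvd_order[OF _ rs[OF s]] finite_S[OF s] by (simp add: ms_def)
    hence "ms s dvd s ^ multiplicity s N"
      using card_S[OF s] by (simp add: Coset.order_def prime_part_def)
    thus ?thesis using divides_primepow_nat[OF P_prime[OF s]] by blast
  qed
  then obtain i where i: "\<And>s. s \<in> P \<Longrightarrow> ms s = s ^ i s" by metis
  have prod_eq: "(\<Prod>s\<in>P. ms s) = (\<Prod>s\<in>P. s ^ i s)" by (intro prod.cong) (auto simp: i)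
  have mult: "multiplicity r (\<Prod>s\<in>P. ms s) = i r"
    unfolding prod_eq using multiplicity_prod_prime_powers[OF finite_P P_prime P_prime[OF r], of i] r
    by simp
  have "multiplicity r (ms r) = i r" using i[OF r] P_prime[OF r] by simp
  moreover have "multiplicity r (ms r) \<le> multiplicity r m"
    using ms_m[OF r] m0 by (intro dvd_imp_multiplicity_le) auto
  moreover have "multiplicity r m \<le> multiplicity r (\<Prod>s\<in>P. ms s)"
  proof (intro dvd_imp_multiplicity_le[OF m_prod])
    show "(\<Prod>s\<in>P. ms s) \<noteq> 0" using dvd_pos_nat[OF m0 ms_m] finite_P by (auto simp: prod_zero_iff)
  qed
  ultimately have "multiplicity r m = i r" using mult by simp
  thus ?thesis using i[OF r] by (simp add: prime_part_def m_def ms_def)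
qed

lemma card_I_chars_sylow:
  assumes d: "d > 0" "d dvd N"
  shows "card (I_chars d G) = (\<Prod>r\<in>P. card (I_chars (prime_part r d) (H r)))"
proof -
  have I_H: "I_chars (prime_part r d) (H r) =
      {\<psi> \<in> lin_chars (H r). lcm 2 (char_order (H r) \<psi>) = lcm 2 (prime_part r d)}" if r: "r \<in> P" for r
    by (rule comm_group.I_chars_eq[OF comm_group_H[OF r]])
       (use finite_S[OF r] prime_part_pos[OF P_prime[OF r]] in auto)
  have "bij_betw sylow_restriction {\<chi> \<in> lin_chars G. lcm 2 (char_order G \<chi>) = lcm 2 d}
     {\<psi> \<in> PiE P (\<lambda>r. lin_chars (H r)).
        \<forall>r\<in>P. lcm 2 (char_order (H r) (\<psi> r)) = lcm 2 (prime_part r d)}"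
  proof (rule bij_betw_Collect[OF bij_betw_restrict_sylow])
    fix \<chi> assume \<chi>: "\<chi> \<in> lin_chars G"
    show "(\<forall>r\<in>P. lcm 2 (char_order (H r) (sylow_restriction \<chi> r)) = lcm 2 (prime_part r d)) \<longleftrightarrow>
        lcm 2 (char_order G \<chi>) = lcm 2 d"
      using lcm_2_eq_iff_prime_parts[OF N_pos char_order_dvd_order[OF fin \<chi>] d(2) P_def]
        char_order_restrict_sylow[OF \<chi>] by simp
  qed
  also have "{\<psi> \<in> PiE P (\<lambda>r. lin_chars (H r)).
        \<forall>r\<in>P. lcm 2 (char_order (H r) (\<psi> r)) = lcm 2 (prime_part r d)} =
      PiE P (\<lambda>r. I_chars (prime_part r d) (H r))"
    using I_H by (auto simp: PiE_iff extensional_def)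
  finally have "bij_betw sylow_restriction (I_chars d G) (PiE P (\<lambda>r. I_chars (prime_part r d) (H r)))"
    unfolding I_chars_eq[OF fin d(1)] .
  hence "card (I_chars d G) = card (PiE P (\<lambda>r. I_chars (prime_part r d) (H r)))"
    by (rule bij_betw_same_card)
  thus ?thesis using finite_P by (simp add: card_PiE)
qed

end

section \<open>Counting in primary groups and in the whole group\<close>

text \<open>In an \<open>r\<close>-group all character orders are powers of \<open>r\<close>. Apart from the excluded pair, the field
\<open>\<rat>(\<zeta>)\<close> for \<open>\<zeta>\<close> of order \<open>r ^ l\<close> determines \<open>l\<close>, so the characters in question are those of exact
order \<open>r ^ l\<close>.\<close>

lemma (in comm_group) card_I_chars_primary:
  assumes fin: "finite (carrier G)" and r: "prime r" and ord: "Coset.order G = r ^ b"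
    and l: "l \<ge> 1" "(r, l) \<noteq> (2, 1)"
  shows "int (card (I_chars (r ^ l) G)) =
    int (card (torsion_chars G (r ^ l))) - int (card (torsion_chars G (r ^ (l - 1))))"
proof -
  have r1: "r > 1" using r prime_gt_1_nat by blast
  have tor: "torsion_chars G k = {\<chi> \<in> lin_chars G. char_order G \<chi> dvd k}" for k
    using char_order_dvd_iff[OF fin] by (auto simp: torsion_chars_def)
  have lcm_iff: "lcm 2 (r ^ i) = lcm 2 (r ^ l) \<longleftrightarrow> i = l" for i
  proof
    assume eq: "lcm 2 (r ^ i) = lcm 2 (r ^ l)"
    have "multiplicity r (lcm 2 (r ^ i)) = multiplicity r (lcm 2 (r ^ l))" by (simp only: eq)
    hence "max (multiplicity r 2) i = max (multiplicity r 2) l"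
      using r r1 by (simp add: prime_multiplicity_lcm)
    moreover have "multiplicity r 2 = (if r = 2 then 1 else 0)"
      using r by (auto simp: prime_multiplicity_other)
    ultimately show "i = l" using l by (auto simp: max_def split: if_splits)
  qed simp
  have char_order: "\<exists>i. char_order G \<chi> = r ^ i" if "\<chi> \<in> lin_chars G" for \<chi>
    using char_order_dvd_order[OF fin that] divides_primepow_nat[OF r] ord by auto
  have dvd_iff: "r ^ i dvd r ^ j \<longleftrightarrow> i \<le> j" for i j
    using r1 by (auto intro: le_imp_power_dvd power_dvd_imp_le)
  have "I_chars (r ^ l) G = torsion_chars G (r ^ l) - torsion_chars G (r ^ (l - 1))"
  proof -
    have "lcm 2 (char_order G \<chi>) = lcm 2 (r ^ l) \<longleftrightarrow>
       char_order G \<chi> dvd r ^ l \<and> \<not> char_order G \<chi> dvd r ^ (l - 1)" if \<chi>: "\<chi> \<in> lin_chars G" for \<chi>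
    proof -
      obtain i where i: "char_order G \<chi> = r ^ i" using char_order[OF \<chi>] by blast
      have "i = l \<longleftrightarrow> i \<le> l \<and> \<not> i \<le> l - 1" using l(1) by linarith
      thus ?thesis by (simp only: i lcm_iff dvd_iff)
    qed
    thus ?thesis using I_chars_eq[OF fin, of "r ^ l"] r1 by (auto simp: tor)
  qed
  moreover have sub: "torsion_chars G (r ^ (l - 1)) \<subseteq> torsion_chars G (r ^ l)"
    using dvd_trans[OF _ le_imp_power_dvd[of "l - 1" l r]] by (auto simp: tor)
  moreover have "finite (torsion_chars G k)" for k
    using finite_lin_chars[OF fin] by (simp add: tor)
  ultimately show ?thesis by (simp add: card_Diff_subset card_mono of_nat_diff)
qed

lemma (in comm_group) I_chars_2:
  assumes fin: "finite (carrier G)"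
  shows "I_chars 2 G = torsion_chars G 2"
proof -
  have "lcm 2 m = 2 \<longleftrightarrow> m dvd 2" for m :: nat
    by (metis dvd_lcm2 lcm_proj1_if_dvd_nat)
  thus ?thesis using I_chars_eq[OF fin, of 2] char_order_dvd_iff[OF fin]
    by (auto simp: torsion_chars_def)
qed

lemma gcd_powers_nat: "gcd (r ^ i) (r ^ j) = (r :: nat) ^ min j i"
proof (cases "i \<le> j")
  case True
  thus ?thesis by (simp add: min_def gcd_proj1_if_dvd_nat le_imp_power_dvd)
next
  case False
  thus ?thesis by (simp add: min_def gcd_proj2_if_dvd_nat le_imp_power_dvd)
qed

lemma (in comm_group) group_exponent_dvd_order:
  assumes fin: "finite (carrier G)"
  shows "group_exponent G dvd Coset.order G"
proof -
  let ?Q = "\<lambda>m. m > 0 \<and> (\<forall>x\<in>carrier G. x [^] (m :: nat) = \<one>)"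
  define e where "e = group_exponent G"
  have "?Q (Coset.order G)" using pow_order_eq_1 fin order_gt_0_iff_finite by auto
  hence e: "?Q e" unfolding e_def group_exponent_def by (rule LeastI)
  have "x [^] (Coset.order G mod e) = \<one>" if x: "x \<in> carrier G" for x
  proof -
    have "\<one> = x [^] (e * (Coset.order G div e) + Coset.order G mod e)"
      using pow_order_eq_1[OF x] by simp
    also have "\<dots> = (x [^] e) [^] (Coset.order G div e) \<otimes> x [^] (Coset.order G mod e)"
      using x by (simp only: nat_pow_mult nat_pow_pow)
    finally show ?thesis using e x by simp
  qed
  hence "Coset.order G mod e = 0"
    using e not_less_Least[of "Coset.order G mod e" ?Q]
    by (metis e_def group_exponent_def mod_less_divisor not_gr_zero)
  thus ?thesis by (simp add: e_def mod_eq_0_iff_dvd)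
qed

theorem mainTheorem3:
  fixes G :: "('a, 'b) monoid_scheme"
    and e :: nat
    and P :: "nat set"
    and S :: "nat \<Rightarrow> 'a set"
    and n :: "nat \<Rightarrow> nat"
    and a :: "nat \<Rightarrow> nat \<Rightarrow> nat"
  assumes "comm_group G" and "finite (carrier G)"
    and "e = group_exponent G"
    and "P = {r. prime r \<and> r dvd Coset.order G}"
    and "\<And>r. r \<in> P \<Longrightarrow> sylow_subgroup G r (S r)"
    and "\<And>r. r \<in> P \<Longrightarrow>
           G\<lparr>carrier := S r\<rparr> \<cong> sum_group {1..n r} (\<lambda>j. integer_mod_group (r ^ a r j))"
    and "\<And>r j. r \<in> P \<Longrightarrow> j \<in> {1..n r} \<Longrightarrow> 1 \<le> a r j"
    and "\<And>r i j. r \<in> P \<Longrightarrow> 1 \<le> i \<Longrightarrow> i \<le> j \<Longrightarrow> j \<le> n r \<Longrightarrow> a r i \<le> a r j"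
  shows "(\<forall>d. d > 0 \<and> d dvd e \<longrightarrow>
            card (I_chars d G) =
              (\<Prod>r\<in>P. card (I_chars (prime_part r d) (G\<lparr>carrier := S r\<rparr>)))) \<and>
         (\<forall>r\<in>P. \<forall>l. 1 \<le> l \<and> l \<le> a r (n r) \<and> (r, l) \<noteq> (2, 1) \<longrightarrow>
            int (card (I_chars (r ^ l) (G\<lparr>carrier := S r\<rparr>))) =
              (\<Prod>j=1..n r. int r ^ min l (a r j)) - (\<Prod>j=1..n r. int r ^ min (l - 1) (a r j))) \<and>
         (2 \<in> P \<longrightarrow> card (I_chars 2 (G\<lparr>carrier := S 2\<rparr>)) = 2 ^ n 2)"
proof -
  interpret abelian_sylow_family G S P
    using assms by (simp add: abelian_sylow_family_def abelian_sylow_family_axioms_def)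
  have torsion: "card (torsion_chars (G\<lparr>carrier := S r\<rparr>) (r ^ k)) = (\<Prod>j=1..n r. r ^ min k (a r j))"
    if r: "r \<in> P" for r k
  proof -
    have "card (torsion_chars (G\<lparr>carrier := S r\<rparr>) (r ^ k)) =
      card (torsion_chars (sum_group {1..n r} (\<lambda>j. integer_mod_group (r ^ a r j))) (r ^ k))"
      using comm_group_H[OF r] finite_S[OF r] assms(6)[OF r]
      by (intro torsion_chars_iso) (auto simp: comm_group_def)
    also have "\<dots> = (\<Prod>j=1..n r. gcd (r ^ a r j) (r ^ k))"
      using prime_gt_0_nat[OF P_prime[OF r]] by (intro card_torsion_chars_sum_group) auto
    finally show ?thesis by (simp add: gcd_powers_nat)
  qed
  have "card (I_chars d G) = (\<Prod>r\<in>P. card (I_chars (prime_part r d) (G\<lparr>carrier := S r\<rparr>)))"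
    if "d > 0" "d dvd e" for d
    using card_I_chars_sylow that dvd_trans group_exponent_dvd_order[OF fin] assms(3) by blast
  moreover have "int (card (I_chars (r ^ l) (G\<lparr>carrier := S r\<rparr>))) =
      (\<Prod>j=1..n r. int r ^ min l (a r j)) - (\<Prod>j=1..n r. int r ^ min (l - 1) (a r j))"
    if r: "r \<in> P" and l: "1 \<le> l" "(r, l) \<noteq> (2, 1)" for r l
  proof -
    interpret Hr: comm_group "G\<lparr>carrier := S r\<rparr>" by (rule comm_group_H[OF r])
    have "Coset.order (G\<lparr>carrier := S r\<rparr>) = r ^ multiplicity r N"
      using card_S[OF r] by (simp add: Coset.order_def prime_part_def)
    from Hr.card_I_chars_primary[OF _ P_prime[OF r] this l] show ?thesis
      using finite_S[OF r] by (simp add: torsion[OF r])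
  qed
  moreover have "card (I_chars 2 (G\<lparr>carrier := S 2\<rparr>)) = 2 ^ n 2" if P2: "2 \<in> P"
  proof -
    interpret H2: comm_group "G\<lparr>carrier := S 2\<rparr>" by (rule comm_group_H[OF P2])
    have "card (I_chars 2 (G\<lparr>carrier := S 2\<rparr>)) = (\<Prod>j=1..n 2. 2 ^ min 1 (a 2 j))"
      using H2.I_chars_2 finite_S[OF P2] torsion[OF P2, of 1] by simp
    also have "\<dots> = (\<Prod>j=1..n 2. 2)"
      using assms(7)[OF P2] by (intro prod.cong) (auto simp: min_def)
    finally show ?thesis by simp
  qed
  ultimately show ?thesis by blast
qed

end
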